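(* For all integers $n\ge 1$ and $a,b\ge 0$ there exists a bijection $\zeta:\widetilde{\mathcal D}_n^{(a,b)}\to\widehat{\mathcal D}_n^{(b,a)}$ such that for every $D\in\widetilde{\mathcal D}_n^{(a,b)}$ we have $\mathsf{area}(D)=\mathsf{bounce}(\zeta(D))$ and $\mathsf{dinv}(D)=\mathsf{area}(\zeta(D))$.
   Context: A Dyck path of size $n$ is a lattice path from $(0,0)$ to $(n,n)$ with unit north and east steps staying weakly above $y=x$. Its $i$-th north step lies in row $i$; the area word is $w_1(D)\cdots w_n(D)$, $w_i(D)$ being the number of whole unit squares in row $i$ between the path and $y=x$. A peak is a north step followed by an east step; a rise is a north step followed by a north step. $\mathcal D_n^{(a,b)}$ is the set of Dyck paths of size $n$ with a choice of $a$ decorated peaks and $b$ decorated rises. $\mathsf{Peak}(D)$ (resp. $\mathsf{Rise}(D)$) is the set of $i$ such that the $i$-th north step is a decorated peak (resp. rise). $\mathsf{area}(D)=\sum_i w_i(D)-\sum_{j\in\mathsf{Rise}(D)}w_{j+1}(D)$. $\mathsf{dinv}(D)$ is the number of pairs $1\le i<j\le n$ with either $w_i=w_j$ and $i\notin\mathsf{Peak}(D)$, or $w_i=w_j+1$ and $j\notin\mathsf{Peak}(D)$. The first bounce path starts at $(0,0)$, goes north until it reaches the starting point of an east step of $D$, then east until it reaches $y=x$, then north, and so on until $(n,n)$; its north steps are labelled $0$ before its first north-to-east turn, $1$ between the first and second turns, etc.; $b_i(D)$ is the label in row $i$ and $\mathsf{bounce}(D)=\sum_{i\notin\mathsf{Peak}(D)}b_i(D)$.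 $\widetilde{\mathcal D}_n^{(a,b)}\subseteq\mathcal D_n^{(a,b)}$ consists of the elements whose rightmost highest peak (the peak in row $i$ with $w_i$ maximal and $i$ largest among such) is not decorated; $\widehat{\mathcal D}_n^{(a,b)}\subseteq\mathcal D_n^{(a,b)}$ consists of the elements whose first peak (the peak in the leftmost column) is not decorated. *)

theory Defs
  imports Main
begin

datatype step = North | East

text \<open>Rows, i.e. north steps, are numbered from 1. Positions in a step list are numbered from 0;
  the step at position \<open>p\<close> starts at the lattice point
  \<open>(count_list (take p D) East, count_list (take p D) North)\<close>.\<close>

definition dyck_path :: "nat \<Rightarrow> step list \<Rightarrow> bool" where
  "dyck_path n D \<longleftrightarrow>
     count_list D North = n \<and> count_list D East = n \<and>
     (\<forall>p\<le>length D. count_list (take p D) East \<le> count_list (take p D) North)"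

definition north_pos :: "step list \<Rightarrow> nat \<Rightarrow> nat" where
  "north_pos D i =
     (THE p. p < length D \<and> D ! p = North \<and> count_list (take (Suc p) D) North = i)"

definition north_col :: "step list \<Rightarrow> nat \<Rightarrow> nat" where
  "north_col D i = count_list (take (north_pos D i) D) East"

text \<open>Row \<open>i\<close> is the strip between heights \<open>i - 1\<close> and \<open>i\<close>. The set below consists of the
  \<open>x\<close>-coordinates \<open>k\<close> of the left sides of the unit squares of this row which lie to the right of
  the \<open>i\<close>-th north step and whose lower right corner \<open>(k + 1, i - 1)\<close> is weakly above \<open>y = x\<close>.\<close>

definition area_word :: "step list \<Rightarrow> nat \<Rightarrow> nat" where
  "area_word D i = card {k. north_col D i \<le> k \<and> k + 1 \<le> i - 1}"

definition peak_rows :: "step list \<Rightarrow> nat set" where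
  "peak_rows D = {i. 1 \<le> i \<and> i \<le> count_list D North \<and>
     Suc (north_pos D i) < length D \<and> D ! Suc (north_pos D i) = East}"

definition rise_rows :: "step list \<Rightarrow> nat set" where
  "rise_rows D = {i. 1 \<le> i \<and> i \<le> count_list D North \<and>
     Suc (north_pos D i) < length D \<and> D ! Suc (north_pos D i) = North}"

record decorated_path =
  path :: "step list"
  Peak :: "nat set"
  Rise :: "nat set"

definition decorated_dyck_paths :: "nat \<Rightarrow> nat \<Rightarrow> nat \<Rightarrow> decorated_path set" where
  "decorated_dyck_paths n a b = {D. dyck_path n (path D) \<and>
     Peak D \<subseteq> peak_rows (path D) \<and> card (Peak D) = a \<and>
     Rise D \<subseteq> rise_rows (path D) \<and> card (Rise D) = b}"

abbreviation size_of :: "decorated_path \<Rightarrow> nat" where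
  "size_of D \<equiv> count_list (path D) North"

definition area :: "decorated_path \<Rightarrow> int" where
  "area D = (\<Sum>i=1..size_of D. int (area_word (path D) i))
          - (\<Sum>j\<in>Rise D. int (area_word (path D) (j + 1)))"

definition dinv :: "decorated_path \<Rightarrow> nat" where
  "dinv D = card {(i, j). 1 \<le> i \<and> i < j \<and> j \<le> size_of D \<and>
     (area_word (path D) i = area_word (path D) j \<and> i \<notin> Peak D \<or>
      area_word (path D) i = area_word (path D) j + 1 \<and> j \<notin> Peak D)}"

definition east_starts :: "step list \<Rightarrow> (nat \<times> nat) set" where
  "east_starts D = {(count_list (take p D) East, count_list (take p D) North) | p.
     p < length D \<and> D ! p = East}"

text \<open>The \<open>m\<close>-th return (counted from 0, which is the origin) of the first bounce path to the
  diagonal is at \<open>(t, t)\<close> with \<open>t = bounce_return D m\<close>. From there the bounce path goes north along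
  \<open>x = t\<close> up to the first starting point \<open>(t, y)\<close> of an east step of \<open>D\<close>, and then east to
  \<open>(y, y)\<close>. The sequence is constant once the end point of \<open>D\<close> is reached.\<close>

primrec bounce_return :: "step list \<Rightarrow> nat \<Rightarrow> nat" where
  "bounce_return D 0 = 0"
| "bounce_return D (Suc m) =
     (if bounce_return D m < count_list D North
      then (LEAST y. bounce_return D m \<le> y \<and> (bounce_return D m, y) \<in> east_starts D)
      else bounce_return D m)"

text \<open>The north steps of the bounce path between its \<open>m\<close>-th and \<open>(m + 1)\<close>-st return are exactly
  those preceded by \<open>m\<close> north-to-east turns; they occupy the rows from
  \<open>bounce_return D m + 1\<close> to \<open>bounce_return D (m + 1)\<close>.\<close>

definition bounce_word :: "step list \<Rightarrow> nat \<Rightarrow> nat" where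
  "bounce_word D i = (THE m. bounce_return D m < i \<and> i \<le> bounce_return D (Suc m))"

definition bounce :: "decorated_path \<Rightarrow> nat" where
  "bounce D = (\<Sum>i\<in>{1..size_of D} - Peak D. bounce_word (path D) i)"

definition rightmost_highest_peak :: "step list \<Rightarrow> nat" where
  "rightmost_highest_peak D =
     Max {i \<in> peak_rows D. \<forall>j\<in>peak_rows D. area_word D j \<le> area_word D i}"

definition first_peak :: "step list \<Rightarrow> nat" where
  "first_peak D = (THE i. i \<in> peak_rows D \<and> north_col D i = 0)"

definition decorated_dyck_paths_tilde :: "nat \<Rightarrow> nat \<Rightarrow> nat \<Rightarrow> decorated_path set" where
  "decorated_dyck_paths_tilde n a b =
     {D \<in> decorated_dyck_paths n a b. rightmost_highest_peak (path D) \<notin> Peak D}"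

definition decorated_dyck_paths_hat :: "nat \<Rightarrow> nat \<Rightarrow> nat \<Rightarrow> decorated_path set" where
  "decorated_dyck_paths_hat n a b =
     {D \<in> decorated_dyck_paths n a b. first_peak (path D) \<notin> Peak D}"

end

(* Let w be the area word of a Dyck path D. Sort the 2n pairs (w p, p) and (w p + 1, p)
   lexicographically, and read the former as north and the latter as east steps. This is the
   classical zeta map: the north steps coming from letters w p = v are the v-th block of the first
   bounce path, and the pairs counted by dinv become the area squares. The letter p starts a rise
   of D iff its east step is followed by a north step, namely that of p + 1. Hence rises of D
   correspond to the valleys (east-north corners) of the image, which in each block v >= 1 are as
   many as its peaks, while block 0 contains just the first peak. Peaks of D other than the
   rightmost highest one correspond to double east steps, and the number of double east steps with
   their middle point at a given distance from the diagonal equals that of double north steps. So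
   only the existence of bijections preserving the respective statistics is needed to move the
   decorations. *)
theory Submission
  imports Defs "HOL-Library.Product_Lexorder"
begin

section \<open>Rows and area words of lattice paths\<close>

text \<open>Decorating a peak p removes \<open>weight p\<close> pairs from dinv, and the image of
  the word is at exactly this distance from the diagonal after the east step of p. Decorating a rise
  of the image removes an area letter, which is the distance from the diagonal in the middle of a
  double north step. This is why double steps are compared height by height. The two exceptional
  peaks are those without a partner: the east step of the rightmost highest peak is the last step of
  the image, and the run of north steps ending at the first peak is preceded by no valley. The
  bijections are chosen once for every undecorated path, so that decorations are transported as sets
  and can be recovered. Bijectivity of the classical map is derived from injectivity and finiteness:
  if two images have the same bounce path, then at the first position where the words differ the
  larger letter produces a north step where the other image has an east step.\<close>

lemma not_North_iff: "s \<noteq> North \<longleftrightarrow> s = East"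
  by (cases s) auto

lemma count_list_take_Suc:
  "k < length D \<Longrightarrow> count_list (take (Suc k) D) s = count_list (take k D) s + (if D ! k = s then 1 else 0)"
  by (simp add: take_Suc_conv_app_nth)

lemma count_list_take_mono: "k \<le> l \<Longrightarrow> count_list (take k D) s \<le> count_list (take l D) s"
  using take_add[of k "l - k" D] by simp

lemma count_list_take_le: "count_list (take k D) s \<le> count_list D s"
  using count_list_append[of "take k D" "drop k D" s] by simp

lemma count_list_take_less:
  assumes "k < l" "k < length D" "D ! k = s"
  shows "count_list (take k D) s < count_list (take l D) s"
  using count_list_take_mono[of "Suc k" l D s] assms by (simp add: count_list_take_Suc)

lemma count_list_take_inj:
  assumes "k < length D" "D ! k = s" "l < length D" "D ! l = s"
    and "count_list (take k D) s = count_list (take l D) s"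
  shows "k = l"
  using assms count_list_take_less[of k l D s] count_list_take_less[of l k D s]
  by (metis less_irrefl linorder_neqE_nat)

lemma count_North_East: "count_list D North + count_list D East = length D"
proof (induction D)
  case (Cons s D)
  then show ?case by (cases s) auto
qed simp

lemma north_pos_eqI:
  assumes "k < length D" "D ! k = North" "Suc (count_list (take k D) North) = i"
  shows "north_pos D i = k"
  unfolding north_pos_def
proof (rule the_equality)
  show "k < length D \<and> D ! k = North \<and> count_list (take (Suc k) D) North = i"
    using assms by (simp add: count_list_take_Suc)
next
  fix p
  assume "p < length D \<and> D ! p = North \<and> count_list (take (Suc p) D) North = i"
  then show "p = k"
    using assms by - (rule count_list_take_inj[of _ D North], auto simp: count_list_take_Suc)
qed

lemma ex_nth_step:
  assumes "i < count_list D s"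
  obtains k where "k < length D" "D ! k = s" "count_list (take k D) s = i"
proof -
  have "\<exists>k<length D. D ! k = s \<and> count_list (take k D) s = i"
    using assms
  proof (induction D rule: rev_induct)
    case (snoc t D)
    show ?case
    proof (cases "i < count_list D s")
      case True
      with snoc obtain k where "k < length D" "D ! k = s" "count_list (take k D) s = i" by auto
      then show ?thesis by (intro exI[of _ k]) (auto simp: nth_append)
    next
      case False
      with snoc.prems show ?thesis
        by (intro exI[of _ "length D"]) (auto split: if_splits)
    qed
  qed simp
  with that show thesis by blast
qed

lemma north_pos_props:
  assumes "i \<in> {1..count_list D North}"
  shows "north_pos D i < length D" "D ! north_pos D i = North"
    "count_list (take (north_pos D i) D) North = i - 1"
proof -
  have "i - 1 < count_list D North" using assms by auto
  then obtain k where k: "k < length D" "D ! k = North" "count_list (take k D) North = i - 1"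
    by (rule ex_nth_step)
  moreover from k have "north_pos D i = k"
    using assms by (intro north_pos_eqI) auto
  ultimately show "north_pos D i < length D" "D ! north_pos D i = North"
    "count_list (take (north_pos D i) D) North = i - 1" by auto
qed

lemma north_pos_conv_col:
  assumes "i \<in> {1..count_list D North}"
  shows "north_pos D i = i - 1 + north_col D i"
  using north_pos_props[OF assms] count_North_East[of "take (north_pos D i) D"]
  by (simp add: north_col_def)

text \<open>The subtraction is truncated; for Dyck paths \<open>north_col_le\<close> makes it exact,
  so that the area word determines the columns.\<close>

lemma area_word_conv_col: "area_word D i = i - 1 - north_col D i"
proof -
  have "{k. north_col D i \<le> k \<and> k + 1 \<le> i - 1} = {north_col D i..<i - 1}" by auto
  then show ?thesis by (simp add: area_word_def)
qed

lemma row_of_north: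
  assumes "k < length D" "D ! k = North"
  shows "Suc (count_list (take k D) North) \<in> {1..count_list D North}"
  using count_list_take_le[of "Suc k" D North] assms by (auto simp: count_list_take_Suc)

lemma north_pos_mono:
  assumes "1 \<le> i" "i < j" "j \<le> count_list D North"
  shows "north_pos D i < north_pos D j"
proof (rule ccontr)
  assume "\<not> ?thesis"
  then have "count_list (take (north_pos D j) D) North \<le> count_list (take (north_pos D i) D) North"
    by (intro count_list_take_mono) simp
  then show False using north_pos_props[of i D] north_pos_props[of j D] assms by auto
qed

lemma dyck_pathD:
  assumes "dyck_path n D"
  shows "count_list D North = n" "count_list D East = n" "length D = 2 * n"
    "count_list (take k D) East \<le> count_list (take k D) North"
proof -
  show *: "count_list D North = n" "count_list D East = n"
    using assms by (auto simp: dyck_path_def)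
  then show "length D = 2 * n" using count_North_East[of D] by simp
  show "count_list (take k D) East \<le> count_list (take k D) North"
    using assms by (cases "k \<le> length D") (auto simp: dyck_path_def)
qed

lemma finite_dyck_paths: "finite {D. dyck_path n D}"
proof (rule finite_subset)
  have "s \<in> {North, East}" for s by (cases s) auto
  then show "{D. dyck_path n D} \<subseteq> {D. set D \<subseteq> {North, East} \<and> length D = 2 * n}"
    using dyck_pathD(3) by blast
  show "finite {D. set D \<subseteq> {North, East} \<and> length D = 2 * n}"
    by (rule finite_lists_length_eq) simp
qed

lemma north_col_le:
  assumes "dyck_path n D" "i \<in> {1..n}"
  shows "north_col D i \<le> i - 1"
  using dyck_pathD(1)[OF assms(1)] dyck_pathD(4)[OF assms(1), of "north_pos D i"]
    north_pos_props(3)[of i D] assms(2)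
  by (simp add: north_col_def)

text \<open>The area letters give the columns of the north steps, hence their positions, and all
  other steps are east steps.\<close>

lemma dyck_path_eqI:
  assumes D: "dyck_path n D" and D': "dyck_path n D'"
    and eq: "\<And>i. i \<in> {1..n} \<Longrightarrow> area_word D i = area_word D' i"
  shows "D = D'"
proof (rule nth_equalityI)
  note DD = dyck_pathD[OF D] dyck_pathD[OF D']
  show "length D = length D'" using DD by simp
  have pos: "north_pos D i = north_pos D' i" if "i \<in> {1..n}" for i
    using that north_col_le[OF D that] north_col_le[OF D' that] eq[OF that] DD
      north_pos_conv_col[of i D] north_pos_conv_col[of i D']
    by (simp add: area_word_conv_col)
  have *: "D ! k = North \<longleftrightarrow> k \<in> north_pos D ` {1..n}"
    if "dyck_path n D" "k < length D" for k D
  proof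
    assume "D ! k = North"
    then have "north_pos D (Suc (count_list (take k D) North)) = k"
      using that(2) by (intro north_pos_eqI) auto
    moreover have "Suc (count_list (take k D) North) \<in> {1..n}"
      using row_of_north[OF that(2) \<open>D ! k = North\<close>] dyck_pathD(1)[OF that(1)] by simp
    ultimately show "k \<in> north_pos D ` {1..n}" by (metis imageI)
  next
    assume "k \<in> north_pos D ` {1..n}"
    then show "D ! k = North"
      using north_pos_props(2)[of _ D] dyck_pathD(1)[OF that(1)] by auto
  qed
  have "north_pos D ` {1..n} = north_pos D' ` {1..n}"
    using pos by (rule image_cong[OF refl])
  then have "D ! k = North \<longleftrightarrow> D' ! k = North" if "k < length D" for k
    using *[OF D, of k] *[OF D', of k] that DD(3,7) by simp
  then show "D ! k = D' ! k" if "k < length D" for k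
    using that by (metis not_North_iff)
qed

lemma north_col_rise:
  assumes "1 \<le> i" "i < n" "dyck_path n D"
  shows "north_col D i \<le> north_col D (Suc i)"
    and "i \<in> rise_rows D \<longleftrightarrow> north_col D (Suc i) = north_col D i"
    and "i \<in> peak_rows D \<longleftrightarrow> i \<notin> rise_rows D"
proof -
  note DD = dyck_pathD[OF assms(3)]
  have i: "i \<in> {1..count_list D North}" "Suc i \<in> {1..count_list D North}" using assms DD by auto
  note P = north_pos_props[OF i(1)] north_pos_props[OF i(2)]
  have less: "north_pos D i < north_pos D (Suc i)"
    using assms DD by (intro north_pos_mono) auto
  then show "north_col D i \<le> north_col D (Suc i)"
    by (simp add: north_col_def count_list_take_mono)
  have "i \<in> rise_rows D \<longleftrightarrow> D ! Suc (north_pos D i) = North"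
    using i P less by (auto simp: rise_rows_def)
  also have "\<dots> \<longleftrightarrow> north_pos D (Suc i) = Suc (north_pos D i)"
  proof
    assume "D ! Suc (north_pos D i) = North"
    then show "north_pos D (Suc i) = Suc (north_pos D i)"
      using P less i by (intro north_pos_eqI) (auto simp: count_list_take_Suc)
  next
    assume "north_pos D (Suc i) = Suc (north_pos D i)"
    then show "D ! Suc (north_pos D i) = North" using P(5) by simp
  qed
  also have "\<dots> \<longleftrightarrow> north_col D (Suc i) = north_col D i"
    using north_pos_conv_col[OF i(1)] north_pos_conv_col[OF i(2)] i by auto
  finally show "i \<in> rise_rows D \<longleftrightarrow> north_col D (Suc i) = north_col D i" .
  show "i \<in> peak_rows D \<longleftrightarrow> i \<notin> rise_rows D"
    using i P less by (auto simp: rise_rows_def peak_rows_def not_North_iff)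
qed

text \<open>The last north step is at position at most 2 * (n - 1), so some step follows it; a north
  step there would be one too many.\<close>

lemma last_row_peak:
  assumes "dyck_path n D" "1 \<le> n"
  shows "n \<in> peak_rows D" "n \<notin> rise_rows D"
proof -
  note DD = dyck_pathD[OF assms(1)]
  have i: "n \<in> {1..count_list D North}" using DD assms by auto
  note P = north_pos_props[OF i]
  have len: "Suc (north_pos D n) < length D"
    using north_pos_conv_col[OF i] north_col_le[OF assms(1), of n] DD assms by auto
  have "D ! Suc (north_pos D n) \<noteq> North"
  proof
    assume "D ! Suc (north_pos D n) = North"
    then have "Suc (count_list (take (Suc (north_pos D n)) D) North) \<le> n"
      using row_of_north[OF len] DD by auto
    then show False using P i by (simp add: count_list_take_Suc)
  qed
  moreover from this have "D ! Suc (north_pos D n) = East" by (simp add: not_North_iff)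
  ultimately show "n \<in> peak_rows D" "n \<notin> rise_rows D"
    using i len by (auto simp: peak_rows_def rise_rows_def)
qed

lemma area_word_first: "area_word D 1 = 0"
  by (simp add: area_word_conv_col)

lemma area_word_Suc_le:
  assumes "dyck_path n D" "1 \<le> i" "i < n"
  shows "area_word D (Suc i) \<le> Suc (area_word D i)"
  using north_col_rise(1)[OF assms(2,3,1)] by (simp add: area_word_conv_col)

lemma rise_rows_area_word:
  assumes "dyck_path n D"
  shows "rise_rows D = {i. 1 \<le> i \<and> i < n \<and> area_word D (Suc i) = Suc (area_word D i)}"
proof -
  note DD = dyck_pathD[OF assms]
  have "i \<in> rise_rows D \<longleftrightarrow> area_word D (Suc i) = Suc (area_word D i)" if "1 \<le> i" "i < n" for i
    using north_col_rise[OF that assms] north_col_le[OF assms, of i] north_col_le[OF assms, of "Suc i"] that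
    by (auto simp: area_word_conv_col)
  moreover have "1 \<le> i \<and> i < n" if "i \<in> rise_rows D" for i
    using that DD last_row_peak(2)[OF assms] by (cases "i = n") (auto simp: rise_rows_def)
  ultimately show ?thesis by blast
qed

lemma peak_rows_conv_rise:
  assumes "dyck_path n D"
  shows "peak_rows D = {1..n} - rise_rows D"
proof -
  have "i \<in> peak_rows D \<longleftrightarrow> i \<notin> rise_rows D" if "i \<in> {1..n}" for i
    using that north_col_rise(3)[of i n D] last_row_peak[OF assms] assms
    by (cases "i = n") auto
  moreover have "peak_rows D \<subseteq> {1..n}" using dyck_pathD(1)[OF assms] by (auto simp: peak_rows_def)
  ultimately show ?thesis by blast
qed

section \<open>Double steps at a given height\<close>

text \<open>In both applications P and Q are events that alternate along a path and g is a
  two-valued state, so the two counts differ only by boundary values.\<close>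

lemma card_diff_telescope:
  fixes g :: "nat \<Rightarrow> int"
  assumes "\<And>k. k < m \<Longrightarrow> of_bool (P k) - of_bool (Q k) = g (Suc k) - g k"
  shows "int (card {k. k < m \<and> P k}) - int (card {k. k < m \<and> Q k}) = g m - g 0"
proof -
  have card: "int (card {k. k < m \<and> R k}) = (\<Sum>k<m. of_bool (R k))" for R
    by (simp add: Collect_conj_eq lessThan_def)
  have "int (card {k. k < m \<and> P k}) - int (card {k. k < m \<and> Q k}) =
    (\<Sum>k<m. of_bool (P k) - of_bool (Q k))"
    by (simp only: card sum_subtractf)
  also have "\<dots> = (\<Sum>k<m. g (Suc k) - g k)"
    using assms by (intro sum.cong) auto
  also have "\<dots> = g m - g 0" by (rule sum_lessThan_telescope)
  finally show ?thesis .
qed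

definition height :: "step list \<Rightarrow> nat \<Rightarrow> int" where
  "height D k = int (count_list (take k D) North) - int (count_list (take k D) East)"

lemma height_0 [simp]: "height D 0 = 0"
  by (simp add: height_def)

lemma height_Suc:
  "k < length D \<Longrightarrow> height D (Suc k) = height D k + (if D ! k = North then 1 else -1)"
  by (cases "D ! k") (auto simp: height_def count_list_take_Suc)

lemma height_nonneg: "dyck_path n D \<Longrightarrow> 0 \<le> height D k"
  using dyck_pathD(4)[of n D k] by (simp add: height_def)

lemma height_length: "dyck_path n D \<Longrightarrow> height D (length D) = 0"
  using dyck_pathD(1,2)[of n D] by (simp add: height_def)

text \<open>For d > 0 the path starts and ends below height d. A double north step with its middle
  at height d crosses this height upwards, a double east step crosses it downwards, and the
  crossings alternate.\<close>

lemma card_double_steps: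
  assumes D: "dyck_path n D"
  shows "card {k. Suc k < length D \<and> D ! k = North \<and> D ! Suc k = North \<and> height D (Suc k) = d} =
    card {k. Suc k < length D \<and> D ! k = East \<and> D ! Suc k = East \<and> height D (Suc k) = d}"
    (is "card {k. _ \<and> ?P k} = card {k. _ \<and> ?Q k}")
proof (cases "D = [] \<or> d \<le> 0")
  case True
  \<comment> \<open>At height d \<le> 0 a double step would begin or end below the diagonal.\<close>
  have P: "\<not> ?P k" if "Suc k < length D" "d \<le> 0" for k
    using that height_nonneg[OF D, of k] height_Suc[of k D] by auto
  have Q: "\<not> ?Q k" if "Suc k < length D" "d \<le> 0" for k
    using that height_nonneg[OF D, of "Suc (Suc k)"] height_Suc[of "Suc k" D] by auto
  have "{k. Suc k < length D \<and> ?P k} = {}" "{k. Suc k < length D \<and> ?Q k} = {}"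
    using True P Q by auto
  then show ?thesis by (simp only:)
next
  case False
  define m where "m = length D - 1"
  have len: "length D = Suc m" using False by (simp add: m_def)
  \<comment> \<open>the surplus of double north steps over double east steps just after step \<open>k\<close>\<close>
  let ?g = "\<lambda>k. of_bool (height D (Suc k) > d \<or> height D (Suc k) = d \<and> D ! k = East) :: int"
  have "int (card {k. k < m \<and> ?P k}) - int (card {k. k < m \<and> ?Q k}) = ?g m - ?g 0"
  proof (rule card_diff_telescope)
    fix k assume "k < m"
    then have "height D (Suc (Suc k)) = height D (Suc k) + (if D ! Suc k = North then 1 else -1)"
      using len by (intro height_Suc) simp
    then show "of_bool (?P k) - of_bool (?Q k) = ?g (Suc k) - ?g k"
      by (cases "D ! k"; cases "D ! Suc k"; cases "height D (Suc k) < d"; cases "height D (Suc k) = d")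
        simp_all
  qed
  also have "?g 0 = 0"
    using height_Suc[of 0 D] height_nonneg[OF D, of 1] False len
    by (cases "D ! 0") auto
  also have "?g m = 0"
    using height_length[OF D] len False by simp
  finally show ?thesis using len by simp
qed

section \<open>The zeta map on area words\<close>

text \<open>The k-th smallest element of S is described by order alone: its predecessors form the
  prefix, and no element of S lies strictly between it and the next entry. Adjacent steps of the
  image are later analysed by exhibiting a key in between.\<close>

lemma sorted_list_of_set_nth:
  fixes S :: "'a :: linorder set"
  assumes S: "finite S" and k: "k < card S"
  defines "L \<equiv> sorted_list_of_set S"
  shows "set (take k L) = {x \<in> S. x < L ! k}"
    and "Suc k < card S \<Longrightarrow> L ! k < L ! Suc k"
    and "\<lbrakk>Suc k < card S; x \<in> S; L ! k < x\<rbrakk> \<Longrightarrow> L ! Suc k \<le> x"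
    and "\<lbrakk>x \<in> S; L ! k < x\<rbrakk> \<Longrightarrow> Suc k < card S"
    and "x \<in> S \<Longrightarrow> L ! 0 \<le> x"
    and "L ! k \<in> S"
proof -
  have len: "length L = card S" and set: "set L = S"
    using S by (simp_all add: L_def)
  have less: "L ! i < L ! j" if "i < j" "j < card S" for i j
    using that len strict_sorted_list_of_set[of S] sorted_wrt_iff_nth_less[of "(<)" L]
    by (auto simp: L_def)
  then have iff: "L ! i < L ! j \<longleftrightarrow> i < j" if "i < card S" "j < card S" for i j
    using that by (metis less_asym linorder_neqE_nat less_irrefl)
  have ex: "\<exists>j<card S. L ! j = x" if "x \<in> S" for x
    using that len set by (metis in_set_conv_nth)
  show "L ! k \<in> S" using k len set by (metis nth_mem)
  show "set (take k L) = {x \<in> S. x < L ! k}"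
  proof (intro set_eqI iffI)
    fix x assume "x \<in> set (take k L)"
    then obtain j where "j < k" "L ! j = x"
      using k len by (auto simp: in_set_conv_nth)
    then show "x \<in> {x \<in> S. x < L ! k}"
      using k less[of j k] set nth_mem[of j L] len by auto
  next
    fix x assume x: "x \<in> {x \<in> S. x < L ! k}"
    then obtain j where j: "j < card S" "L ! j = x" using ex by auto
    then have "j < k" using x iff[of j k] k by auto
    then have "j < length (take k L)" "take k L ! j = x" using j k len by auto
    then show "x \<in> set (take k L)" using nth_mem by blast
  qed
  show "Suc k < card S \<Longrightarrow> L ! k < L ! Suc k" using less by simp
  show "L ! Suc k \<le> x" if *: "Suc k < card S" "x \<in> S" "L ! k < x"
  proof -
    obtain j where j: "j < card S" "L ! j = x" using ex[OF *(2)] by auto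
    then have "\<not> L ! j < L ! Suc k" using iff[of j "Suc k"] iff[of k j] * k by auto
    then show ?thesis using j by simp
  qed
  show "Suc k < card S" if *: "x \<in> S" "L ! k < x"
  proof -
    obtain j where j: "j < card S" "L ! j = x" using ex[OF *(1)] by auto
    then show ?thesis using iff[of k j] * k by auto
  qed
  show "L ! 0 \<le> x" if *: "x \<in> S"
  proof -
    obtain j where j: "j < card S" "L ! j = x" using ex[OF *] by auto
    then have "\<not> L ! j < L ! 0" using iff[of j 0] by auto
    then show ?thesis using j by simp
  qed
qed

text \<open>The word is abstracted from the path, so that the images of two words can be
  compared.\<close>

locale area_seq =
  fixes n :: nat and w :: "nat \<Rightarrow> nat"
  assumes n_pos: "1 \<le> n"
    and w_first: "w 1 = 0"
    and w_Suc_le: "\<lbrakk>1 \<le> i; i < n\<rbrakk> \<Longrightarrow> w (Suc i) \<le> Suc (w i)"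
begin

text \<open>The pairs with first component v record one scan of the word from left to right that
  writes a north step for each letter v and an east step for each letter v - 1.\<close>

definition north_key :: "nat \<Rightarrow> nat \<times> nat" where
  "north_key p = (w p, p)"

definition east_key :: "nat \<Rightarrow> nat \<times> nat" where
  "east_key p = (Suc (w p), p)"

definition keys :: "(nat \<times> nat) set" where
  "keys = north_key ` {1..n} \<union> east_key ` {1..n}"

definition step_of :: "nat \<times> nat \<Rightarrow> step" where
  "step_of x = (if fst x = w (snd x) then North else East)"

definition key_list :: "(nat \<times> nat) list" where
  "key_list = sorted_list_of_set keys"

definition zeta :: "step list" where
  "zeta = map step_of key_list"

lemmas key_defs = north_key_def east_key_def

lemma step_of_key [simp]: "step_of (north_key p) = North" "step_of (east_key p) = East"
  by (simp_all add: step_of_def key_defs)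

lemma finite_keys: "finite keys"
  by (simp add: keys_def)

lemma north_key_in [intro]: "p \<in> {1..n} \<Longrightarrow> north_key p \<in> keys"
  and east_key_in [intro]: "p \<in> {1..n} \<Longrightarrow> east_key p \<in> keys"
  by (auto simp: keys_def)

lemma card_keys: "card keys = 2 * n"
proof -
  have "card keys = card (north_key ` {1..n}) + card (east_key ` {1..n})"
    unfolding keys_def by (intro card_Un_disjoint) (auto simp: key_defs)
  also have "\<dots> = 2 * n"
    by (subst (1 2) card_image) (auto simp: inj_on_def key_defs)
  finally show ?thesis .
qed

lemma length_key_list: "length key_list = 2 * n" and length_zeta: "length zeta = 2 * n"
  by (simp_all add: key_list_def zeta_def card_keys)

lemmas key_list_nth = sorted_list_of_set_nth[OF finite_keys, folded key_list_def, unfolded card_keys]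

lemma zeta_nth: "k < 2 * n \<Longrightarrow> zeta ! k = step_of (key_list ! k)"
  by (simp add: zeta_def length_key_list)

lemma key_cases:
  assumes "x \<in> keys"
  obtains p where "p \<in> {1..n}" "x = north_key p" | p where "p \<in> {1..n}" "x = east_key p"
  using assms by (auto simp: keys_def)

lemma count_list_map_step_of:
  "count_list (map step_of xs) s = card {x \<in> set xs. step_of x = s}" if "distinct xs"
proof -
  have "count_list (map step_of xs) s = length (filter (\<lambda>x. step_of x = s) xs)"
    by (simp add: count_list_eq_length_filter filter_map comp_def eq_commute)
  also have "\<dots> = card {x \<in> set xs. step_of x = s}"
    using that distinct_card[of "filter (\<lambda>x. step_of x = s) xs"] by simp
  finally show ?thesis .
qed

lemma card_north: "card {x \<in> keys. R x \<and> step_of x = North} = card {q \<in> {1..n}. R (north_key q)}"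
proof -
  have "{x \<in> keys. R x \<and> step_of x = North} = north_key ` {q \<in> {1..n}. R (north_key q)}"
    by (auto simp: keys_def)
  then show ?thesis by (simp add: card_image inj_on_def key_defs)
qed

lemma card_east: "card {x \<in> keys. R x \<and> step_of x = East} = card {q \<in> {1..n}. R (east_key q)}"
proof -
  have "{x \<in> keys. R x \<and> step_of x = East} = east_key ` {q \<in> {1..n}. R (east_key q)}"
    by (auto simp: keys_def)
  then show ?thesis by (simp add: card_image inj_on_def key_defs)
qed

text \<open>A prefix of the sorted list is an initial segment of the keys.\<close>

lemma count_take_zeta:
  assumes "k < 2 * n"
  shows "count_list (take k zeta) North = card {q \<in> {1..n}. north_key q < key_list ! k}"
    and "count_list (take k zeta) East = card {q \<in> {1..n}. east_key q < key_list ! k}"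
proof -
  have "distinct (take k key_list)" by (simp add: key_list_def)
  then have "count_list (take k zeta) s = card {x \<in> keys. x < key_list ! k \<and> step_of x = s}" for s
    using assms by (simp add: zeta_def take_map count_list_map_step_of key_list_nth(1) conj_assoc)
  then show "count_list (take k zeta) North = card {q \<in> {1..n}. north_key q < key_list ! k}"
    "count_list (take k zeta) East = card {q \<in> {1..n}. east_key q < key_list ! k}"
    by (simp_all only: card_north card_east)
qed

lemma count_zeta: "count_list zeta North = n" "count_list zeta East = n"
proof -
  have "distinct key_list" "set key_list = keys" by (simp_all add: key_list_def finite_keys)
  then have "count_list zeta s = card {x \<in> keys. True \<and> step_of x = s}" for s
    by (simp add: zeta_def count_list_map_step_of)
  moreover have "{q \<in> {1..n}. True} = {1..n}" by auto
  ultimately show "count_list zeta North = n" "count_list zeta East = n"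
    using card_north[of "\<lambda>_. True"] card_east[of "\<lambda>_. True"] by simp_all
qed

text \<open>Each east key is preceded by the north key of the same letter.\<close>

lemma dyck_path_zeta: "dyck_path n zeta"
  unfolding dyck_path_def
proof (intro conjI allI impI)
  fix k assume "k \<le> length zeta"
  show "count_list (take k zeta) East \<le> count_list (take k zeta) North"
  proof (cases "k < 2 * n")
    case True
    have "{q \<in> {1..n}. east_key q < key_list ! k} \<subseteq> {q \<in> {1..n}. north_key q < key_list ! k}"
      by (auto simp: key_defs less_prod_def)
    then show ?thesis by (simp add: count_take_zeta[OF True] card_mono)
  next
    case False
    then show ?thesis by (simp add: count_zeta length_zeta)
  qed
qed (simp_all add: count_zeta)

lemma ex_key_index:
  assumes "x \<in> keys"
  obtains k where "k < 2 * n" "key_list ! k = x"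
proof -
  have "x \<in> set key_list" using assms by (simp add: key_list_def finite_keys)
  then obtain k where "k < length key_list" "key_list ! k = x" by (auto simp: in_set_conv_nth)
  then show thesis using that length_key_list by simp
qed

text \<open>A discrete intermediate value argument: the word starts at 0 and rises by at most one at
  a time, so v occurs before p, and after its last occurrence the letters up to p stay above
  v.\<close>

lemma ex_previous_value:
  assumes "1 \<le> p" "p \<le> n" "v < w p"
  obtains q where "1 \<le> q" "q < p" "w q = v" "\<And>r. q < r \<Longrightarrow> r \<le> p \<Longrightarrow> v < w r"
proof -
  have "\<exists>q. 1 \<le> q \<and> q < p \<and> w q = v \<and> (\<forall>r. q < r \<longrightarrow> r \<le> p \<longrightarrow> v < w r)"
    using assms
  proof (induction p rule: dec_induct)
    case base
    then show ?case using w_first by simp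
  next
    case (step p)
    show ?case
    proof (cases "v < w p")
      case True
      with step obtain q where "1 \<le> q" "q < p" "w q = v" "\<forall>r. q < r \<longrightarrow> r \<le> p \<longrightarrow> v < w r"
        by auto
      then show ?thesis using step.prems by (intro exI[of _ q]) (auto simp: le_Suc_eq)
    next
      case False
      then have "w p = v" using w_Suc_le[of p] step by simp
      then show ?thesis using step by (intro exI[of _ p]) (auto simp: le_Suc_eq)
    qed
  qed
  then obtain q where "1 \<le> q" "q < p" "w q = v" and "\<forall>r. q < r \<longrightarrow> r \<le> p \<longrightarrow> v < w r"
    by blast
  then show thesis by (intro that[of q]) auto
qed

end

section \<open>Rises as double north steps at a given height\<close>

lemma height_north_pos:
  assumes "dyck_path n D" "i \<in> {1..n}"
  shows "height D (north_pos D i) = int (area_word D i)"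
  using north_pos_props(3)[of i D] north_col_le[OF assms] assms dyck_pathD(1)[OF assms(1)]
  by (auto simp: height_def area_word_conv_col north_col_def)

lemma inj_on_north_pos: "inj_on (north_pos D) {1..count_list D North}"
proof (rule linorder_inj_onI)
  fix i j assume "i < j" "i \<in> {1..count_list D North}" "j \<in> {1..count_list D North}"
  then show "north_pos D i \<noteq> north_pos D j"
    using north_pos_mono[of i j D] by auto
qed auto

lemma north_pos_Suc:
  assumes "i \<in> rise_rows D"
  shows "north_pos D (Suc i) = Suc (north_pos D i)" "Suc i \<le> count_list D North"
proof -
  have i: "i \<in> {1..count_list D North}" "Suc (north_pos D i) < length D"
    "D ! Suc (north_pos D i) = North" using assms by (auto simp: rise_rows_def)
  note P = north_pos_props[OF i(1)]
  have count: "count_list (take (Suc (north_pos D i)) D) North = i"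
    using P i(1) by (simp add: count_list_take_Suc)
  then show "north_pos D (Suc i) = Suc (north_pos D i)" using i(2,3) by (intro north_pos_eqI) auto
  show "Suc i \<le> count_list D North" using row_of_north[OF i(2,3)] count by simp
qed

text \<open>The second north step of a rise starts at the height given by its own area
  letter.\<close>

lemma card_rises_area:
  assumes D: "dyck_path n D"
  shows "card {j \<in> rise_rows D. area_word D (Suc j) = d} =
    card {k. Suc k < length D \<and> D ! k = North \<and> D ! Suc k = North \<and> height D (Suc k) = int d}"
    (is "card ?A = card ?B")
proof -
  note n = dyck_pathD(1)[OF D]
  have "inj_on (north_pos D) ?A"
    by (rule inj_on_subset[OF inj_on_north_pos]) (auto simp: rise_rows_def)
  moreover have "north_pos D ` ?A = ?B"
  proof (intro set_eqI iffI)
    fix k assume "k \<in> north_pos D ` ?A"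
    then obtain j where j: "j \<in> rise_rows D" "area_word D (Suc j) = d" "k = north_pos D j" by auto
    then have "j \<in> {1..count_list D North}" by (auto simp: rise_rows_def)
    then show "k \<in> ?B"
      using j north_pos_props(2)[of j D] north_pos_Suc[OF j(1)] height_north_pos[OF D, of "Suc j"] n
      by (auto simp: rise_rows_def)
  next
    fix k assume k: "k \<in> ?B"
    define j where "j = Suc (count_list (take k D) North)"
    have pos: "north_pos D j = k" using k by (intro north_pos_eqI) (auto simp: j_def)
    moreover have "j \<in> {1..count_list D North}" using row_of_north[of k D] k by (auto simp: j_def)
    ultimately have j: "j \<in> rise_rows D" using k by (auto simp: rise_rows_def)
    then have "area_word D (Suc j) = d"
      using height_north_pos[OF D, of "Suc j"] north_pos_Suc[OF j] k pos n by auto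
    then show "k \<in> north_pos D ` ?A" using j pos by blast
  qed
  ultimately show ?thesis using card_image by fastforce
qed

context area_seq
begin

section \<open>The bounce path and the area of the image\<close>

text \<open>The row of \<open>zeta\<close> occupied by the north step of letter p: the rank of its
  key among the north keys.\<close>

definition row :: "nat \<Rightarrow> nat" where
  "row p = Suc (card {q \<in> {1..n}. north_key q < north_key p})"

lemma north_key_index:
  assumes "k < 2 * n" "key_list ! k = north_key p"
  shows "zeta ! k = North" "north_pos zeta (row p) = k"
    "north_col zeta (row p) = card {q \<in> {1..n}. east_key q < north_key p}"
proof -
  show N: "zeta ! k = North" using assms by (simp add: zeta_nth)
  have "count_list (take k zeta) North = card {q \<in> {1..n}. north_key q < north_key p}"
    using assms by (simp add: count_take_zeta)
  then show pos: "north_pos zeta (row p) = k"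
    using N assms length_zeta by (intro north_pos_eqI) (auto simp: row_def)
  show "north_col zeta (row p) = card {q \<in> {1..n}. east_key q < north_key p}"
    using assms by (simp add: north_col_def pos count_take_zeta)
qed

lemma zeta_North_obtain:
  assumes "k < 2 * n" "zeta ! k = North"
  obtains p where "p \<in> {1..n}" "key_list ! k = north_key p"
  using key_list_nth(6)[OF assms(1)] assms zeta_nth[OF assms(1)] by (auto elim!: key_cases)

lemma zeta_East_obtain:
  assumes "k < 2 * n" "zeta ! k = East"
  obtains p where "p \<in> {1..n}" "key_list ! k = east_key p"
  using key_list_nth(6)[OF assms(1)] assms zeta_nth[OF assms(1)] by (auto elim!: key_cases)

lemma row_in: "p \<in> {1..n} \<Longrightarrow> row p \<in> {1..n}"
proof -
  assume p: "p \<in> {1..n}"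
  have "{q \<in> {1..n}. north_key q < north_key p} \<subset> {1..n}" using p by blast
  then have "card {q \<in> {1..n}. north_key q < north_key p} < card {1..n}"
    by (intro psubset_card_mono) auto
  then show ?thesis by (simp add: row_def)
qed

lemma bij_betw_row: "bij_betw row {1..n} {1..n}"
proof -
  have "row ` {1..n} = {1..n}"
  proof
    show "row ` {1..n} \<subseteq> {1..n}" using row_in by blast
    show "{1..n} \<subseteq> row ` {1..n}"
    proof
      fix i assume i: "i \<in> {1..n}"
      define k where "k = north_pos zeta i"
      have k: "k < 2 * n" "zeta ! k = North" "count_list (take k zeta) North = i - 1"
        using north_pos_props[of i zeta] i by (auto simp: count_zeta length_zeta k_def)
      obtain p where p: "p \<in> {1..n}" "key_list ! k = north_key p"
        using zeta_North_obtain[OF k(1,2)] .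
      then have "row p = i" using k(3) i by (simp add: row_def count_take_zeta[OF k(1)])
      then show "i \<in> row ` {1..n}" using p by blast
    qed
  qed
  then show ?thesis by (simp add: bij_betw_def finite_surj_inj eq_card_imp_inj_on)
qed

lemma row_obtain:
  assumes "i \<in> {1..n}"
  obtains p k where "p \<in> {1..n}" "i = row p" "k < 2 * n" "key_list ! k = north_key p" "north_pos zeta i = k"
proof -
  have "i \<in> row ` {1..n}" using assms bij_betw_imp_surj_on[OF bij_betw_row] by simp
  then obtain p where p: "p \<in> {1..n}" "i = row p" by blast
  obtain k where k: "k < 2 * n" "key_list ! k = north_key p"
    using ex_key_index[OF north_key_in[OF p(1)]] .
  show thesis using that[OF p k] north_key_index[OF k] p by simp
qed

text \<open>The squares of the row correspond to the letters q whose north step, but not whose east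
  step, precedes the north step of p.\<close>

lemma area_word_zeta:
  assumes "p \<in> {1..n}"
  shows "area_word zeta (row p) =
    card {q \<in> {1..n}. q < p \<and> w q = w p} + card {q \<in> {1..n}. p < q \<and> w p = Suc (w q)}"
proof -
  obtain k where k: "k < 2 * n" "key_list ! k = north_key p"
    using ex_key_index[OF north_key_in[OF assms]] .
  let ?A = "{q \<in> {1..n}. north_key q < north_key p}"
  let ?B = "{q \<in> {1..n}. east_key q < north_key p}"
  have "?B \<subseteq> ?A" by (auto simp: key_defs less_prod_def)
  then have "card ?A - card ?B = card (?A - ?B)" by (simp add: card_Diff_subset)
  also have "?A - ?B = {q \<in> {1..n}. q < p \<and> w q = w p} \<union> {q \<in> {1..n}. p < q \<and> w p = Suc (w q)}"
    by (auto simp: key_defs less_prod_def le_Suc_eq not_less Suc_le_eq)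
  also have "card \<dots> = card {q \<in> {1..n}. q < p \<and> w q = w p} + card {q \<in> {1..n}. p < q \<and> w p = Suc (w q)}"
    by (intro card_Un_disjoint) auto
  finally show ?thesis
    unfolding area_word_conv_col north_key_index(3)[OF k] by (simp add: row_def)
qed

lemma card_values_less_Suc:
  assumes "p \<in> {1..n}"
  shows "card {q \<in> {1..n}. w q < w p} < row p" "row p \<le> card {q \<in> {1..n}. w q < Suc (w p)}"
proof -
  have "{q \<in> {1..n}. w q < w p} \<subseteq> {q \<in> {1..n}. north_key q < north_key p}"
    by (auto simp: key_defs)
  then have "card {q \<in> {1..n}. w q < w p} \<le> card {q \<in> {1..n}. north_key q < north_key p}"
    by (intro card_mono) auto
  then show "card {q \<in> {1..n}. w q < w p} < row p" by (simp add: row_def)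
  have "{q \<in> {1..n}. north_key q < north_key p} \<subset> {q \<in> {1..n}. w q < Suc (w p)}"
    using assms by (auto simp: key_defs less_prod_def)
  then have "card {q \<in> {1..n}. north_key q < north_key p} < card {q \<in> {1..n}. w q < Suc (w p)}"
    by (intro psubset_card_mono) auto
  then show "row p \<le> card {q \<in> {1..n}. w q < Suc (w p)}" by (simp add: row_def)
qed

text \<open>Let r be the number of letters below m. The east step starting in column r belongs to
  the first letter m, and the north steps before it are exactly those of the letters at most
  m.\<close>

lemma bounce_return_zeta: "bounce_return zeta m = card {q \<in> {1..n}. w q < m}"
proof (induction m)
  case 0
  then show ?case by simp
next
  case (Suc m)
  let ?r = "\<lambda>m. card {q \<in> {1..n}. w q < m}"
  have le: "?r m \<le> ?r (Suc m)" by (intro card_mono) auto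
  have "?r (Suc m) \<le> card {1..n}" by (intro card_mono) auto
  then have le_n: "?r (Suc m) \<le> n" by simp
  show ?case
  proof (cases "?r m < n")
    case False
    then show ?thesis using Suc le le_n by (simp add: count_zeta)
  next
    case True
    have "\<exists>q\<in>{1..n}. m \<le> w q"
    proof (rule ccontr)
      assume "\<not> ?thesis"
      then have "{q \<in> {1..n}. w q < m} = {1..n}" by (auto simp: not_le)
      then show False using True by simp
    qed
    then obtain q' where q': "q' \<in> {1..n}" "m \<le> w q'" by blast
    \<comment> \<open>Some letter is at least m, and a letter above m is preceded by one of value
      m.\<close>
    have "\<exists>q. q \<in> {1..n} \<and> w q = m"
    proof (cases "w q' = m")
      case True
      then show ?thesis using q' by blast
    next
      case False
      obtain q where "1 \<le> q" "q < q'" "w q = m"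
        using ex_previous_value[of q' m] q' False by auto
      then show ?thesis using q' by (intro exI[of _ q]) auto
    qed
    define q where "q = (LEAST q. q \<in> {1..n} \<and> w q = m)"
    have q: "q \<in> {1..n}" "w q = m"
      using LeastI_ex[OF \<open>\<exists>q. q \<in> {1..n} \<and> w q = m\<close>] by (auto simp: q_def)
    have least: "w p \<noteq> m" if "p \<in> {1..n}" "p < q" for p
      using not_less_Least[of p "\<lambda>q. q \<in> {1..n} \<and> w q = m"] that by (auto simp: q_def)
    \<comment> \<open>A letter m + 1 before q would be preceded by a letter m, against the choice of
      q.\<close>
    have least': "w p \<noteq> Suc m" if p: "p \<in> {1..n}" "p < q" for p
    proof
      assume "w p = Suc m"
      then obtain r where "1 \<le> r" "r < p" "w r = m" using ex_previous_value[of p m] p by auto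
      then show False using least[of r] p by auto
    qed
    obtain k where k: "k < 2 * n" "key_list ! k = east_key q"
      using ex_key_index[OF east_key_in[OF q(1)]] .
    have "{p \<in> {1..n}. east_key p < east_key q} = {p \<in> {1..n}. w p < m}"
      using q least by (auto simp: key_defs less_prod_def le_less)
    then have E: "count_list (take k zeta) East = ?r m"
      using k by (simp add: count_take_zeta)
    have "{p \<in> {1..n}. north_key p < east_key q} = {p \<in> {1..n}. w p < Suc m}"
      using q least' by (auto simp: key_defs less_prod_def le_less)
    then have N: "count_list (take k zeta) North = ?r (Suc m)"
      using k by (simp add: count_take_zeta)
    have kE: "k < length zeta" "zeta ! k = East" using k by (simp_all add: length_zeta zeta_nth)
    \<comment> \<open>Only one east step starts in this column, so \<open>LEAST\<close> has a single
      candidate.\<close>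
    have mem: "(?r m, y) \<in> east_starts zeta \<longleftrightarrow> y = ?r (Suc m)" for y
    proof
      assume "(?r m, y) \<in> east_starts zeta"
      then obtain l where l: "l < length zeta" "zeta ! l = East"
        "count_list (take l zeta) East = ?r m" "count_list (take l zeta) North = y"
        by (auto simp: east_starts_def)
      have "l = k" using count_list_take_inj[OF l(1,2) kE] l(3) E by simp
      then show "y = ?r (Suc m)" using l N by simp
    next
      assume "y = ?r (Suc m)"
      then show "(?r m, y) \<in> east_starts zeta"
        using kE unfolding east_starts_def mem_Collect_eq
        by (intro exI[of _ k] conjI) (simp_all only: E N)
    qed
    have "bounce_return zeta (Suc m) = (LEAST y. ?r m \<le> y \<and> y = ?r (Suc m))"
      using True by (simp only: bounce_return.simps Suc count_zeta mem if_True)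
    also have "\<dots> = ?r (Suc m)" using le by (intro Least_equality) auto
    finally show ?thesis .
  qed
qed

text \<open>The intervals of rows between successive returns are disjoint, since the returns are
  monotone in m.\<close>

lemma bounce_word_zeta:
  assumes "p \<in> {1..n}"
  shows "bounce_word zeta (row p) = w p"
  unfolding bounce_word_def bounce_return_zeta
proof (rule the_equality)
  show "card {q \<in> {1..n}. w q < w p} < row p \<and> row p \<le> card {q \<in> {1..n}. w q < Suc (w p)}"
    using card_values_less_Suc[OF assms] by simp
next
  fix m assume m: "card {q \<in> {1..n}. w q < m} < row p \<and> row p \<le> card {q \<in> {1..n}. w q < Suc m}"
  have mono: "card {q \<in> {1..n}. w q < i} \<le> card {q \<in> {1..n}. w q < j}" if "i \<le> j" for i j
    using that by (intro card_mono) auto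
  show "m = w p"
  proof (rule linorder_cases[of m "w p"])
    assume "m < w p"
    then show ?thesis using mono[of "Suc m" "w p"] card_values_less_Suc[OF assms] m by simp
  next
    assume "w p < m"
    then show ?thesis using mono[of "Suc (w p)" m] card_values_less_Suc[OF assms] m by simp
  qed
qed

text \<open>No key lies strictly between consecutive entries of the list. If the north step of a
  letter p' follows the east step of p, this forces p' = p + 1.\<close>

lemma north_after_east:
  assumes k: "Suc k < 2 * n" and p: "p \<in> {1..n}" "key_list ! k = east_key p"
  shows "zeta ! Suc k = North \<longleftrightarrow> p < n \<and> w (Suc p) = Suc (w p)"
    and "zeta ! Suc k = North \<Longrightarrow> key_list ! Suc k = north_key (Suc p)"
proof -
  have k': "k < 2 * n" using k by simp
  have less: "east_key p < key_list ! Suc k" using key_list_nth(2)[OF k' k] p by simp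
  have next_le: "key_list ! Suc k \<le> x" if "x \<in> keys" "east_key p < x" for x
    using key_list_nth(3)[OF k' k] that p by simp
  have rise: "p < n \<and> w (Suc p) = Suc (w p)" if N: "zeta ! Suc k = North"
  proof -
    obtain p' where p': "p' \<in> {1..n}" "key_list ! Suc k = north_key p'"
      using zeta_North_obtain[OF k N] .
    have no_east: "\<not> (east_key p < east_key q \<and> east_key q < north_key p')" if "q \<in> {1..n}" for q
      using next_le[OF east_key_in[OF that]] p' by auto
    \<comment> \<open>If w p' were larger, some letter w p' - 1 would precede p', and its east key
      would come strictly in between.\<close>
    have "w p' = Suc (w p) \<and> p < p'"
    proof (rule ccontr)
      assume "\<not> ?thesis"
      then have "Suc (w p) < w p'" using less p' by (auto simp: key_defs less_prod_def)
      moreover obtain q where "1 \<le> q" "q < p'" "w q = w p' - 1"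
        using ex_previous_value[of p' "w p' - 1"] p' calculation by auto
      ultimately show False using no_east[of q] p' by (auto simp: key_defs)
    qed
    \<comment> \<open>Here q is the last letter w p before p'. If q were larger than p, its east key
      would separate the two steps; so q = p and the letter after p is larger.\<close>
    then obtain q where q: "1 \<le> q" "q < p'" "w q = w p" "\<And>r. q < r \<Longrightarrow> r \<le> p' \<Longrightarrow> w p < w r"
      using ex_previous_value[of p' "w p"] p' by auto
    have "p \<le> q" using q(4)[of p] \<open>w p' = Suc (w p) \<and> p < p'\<close> by force
    moreover have "\<not> p < q"
      using no_east[of q] q p' \<open>w p' = Suc (w p) \<and> p < p'\<close> by (auto simp: key_defs)
    ultimately have "w p < w (Suc p)" using q(2) q(4)[of "Suc p"] by auto
    moreover have "p < n" using \<open>w p' = Suc (w p) \<and> p < p'\<close> p' by auto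
    ultimately show ?thesis using w_Suc_le[of p] p by auto
  qed
  \<comment> \<open>The pairs \<open>(Suc (w p), p)\<close> and \<open>(Suc (w p), Suc p)\<close>
    are adjacent in the lexicographic order.\<close>
  have key: "key_list ! Suc k = north_key (Suc p)" if "p < n" "w (Suc p) = Suc (w p)"
  proof -
    have "east_key p < north_key (Suc p)" using that by (simp add: key_defs)
    then have "key_list ! Suc k \<le> north_key (Suc p)" using that by (intro next_le) auto
    then show ?thesis using less that by (cases "key_list ! Suc k") (auto simp: key_defs less_prod_def less_eq_prod_def)
  qed
  show "zeta ! Suc k = North \<longleftrightarrow> p < n \<and> w (Suc p) = Suc (w p)"
    using rise key zeta_nth[OF k] by auto
  show "zeta ! Suc k = North \<Longrightarrow> key_list ! Suc k = north_key (Suc p)"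
    using rise key by blast
qed

text \<open>If the second north step came from a larger letter w p', some letter w p' - 1 before p'
  would have its east key in between.\<close>

lemma level_double_north:
  assumes k: "Suc k < 2 * n" and N: "zeta ! k = North" "zeta ! Suc k = North"
  shows "fst (key_list ! k) = fst (key_list ! Suc k)"
proof (rule ccontr)
  assume neq: "\<not> ?thesis"
  have k': "k < 2 * n" using k by simp
  obtain p where p: "p \<in> {1..n}" "key_list ! k = north_key p" using zeta_North_obtain[OF k' N(1)] .
  obtain p' where p': "p' \<in> {1..n}" "key_list ! Suc k = north_key p'" using zeta_North_obtain[OF k N(2)] .
  have "w p < w p'" using key_list_nth(2)[OF k' k] p p' neq by (auto simp: key_defs less_prod_def)
  moreover obtain q where q: "1 \<le> q" "q < p'" "w q = w p' - 1"
    using ex_previous_value[of p' "w p' - 1"] p' calculation by auto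
  ultimately have "key_list ! k < east_key q" "east_key q < key_list ! Suc k"
    using p p' by (auto simp: key_defs)
  moreover have "east_key q \<in> keys" using q p' by auto
  ultimately show False using key_list_nth(3)[OF k' k, of "east_key q"] by auto
qed


lemma key_list_nth_inj:
  assumes "k < 2 * n" "l < 2 * n" "key_list ! k = key_list ! l"
  shows "k = l"
proof -
  have "distinct key_list" by (simp add: key_list_def)
  then show ?thesis using assms nth_eq_iff_index_eq[of key_list k l] by (simp add: length_key_list)
qed

section \<open>Peaks and rises of the image\<close>

lemma north_not_last:
  assumes "k < 2 * n" "zeta ! k = North"
  shows "Suc k < 2 * n"
proof -
  obtain p where p: "p \<in> {1..n}" "key_list ! k = north_key p" using zeta_North_obtain[OF assms] .
  then have "key_list ! k < east_key p" by (simp add: key_defs)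
  then show ?thesis using key_list_nth(4)[OF assms(1)] p by blast
qed

lemma zeta_first: "zeta ! 0 = North" "fst (key_list ! 0) = 0"
proof -
  have k: "0 < 2 * n" using n_pos by simp
  have "key_list ! 0 \<le> north_key 1"
    using key_list_nth(5)[OF k] n_pos by (auto simp: north_key_in)
  then show level: "fst (key_list ! 0) = 0"
    using w_first by (cases "key_list ! 0") (auto simp: key_defs less_eq_prod_def)
  show "zeta ! 0 = North"
  proof (rule ccontr)
    assume "zeta ! 0 \<noteq> North"
    then have "zeta ! 0 = East" by (simp add: not_North_iff)
    then obtain p where "key_list ! 0 = east_key p" using zeta_East_obtain[OF k] by metis
    then show False using level by (simp add: key_defs)
  qed
qed

text \<open>A maximal run of north steps stays within one block and ends in a peak. It begins after
  a valley, except for the initial run, which belongs to block 0 and accounts for the right-hand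
  side.\<close>

lemma card_peaks_minus_valleys:
  "int (card {k. Suc k < 2 * n \<and> zeta ! k = North \<and> zeta ! Suc k = East \<and> fst (key_list ! k) = v}) -
   int (card {k. Suc k < 2 * n \<and> zeta ! k = East \<and> zeta ! Suc k = North \<and> fst (key_list ! Suc k) = v})
   = of_bool (v = 0)" (is "int (card {k. _ \<and> ?P k}) - int (card {k. _ \<and> ?Q k}) = _")
proof -
  define m where "m = 2 * n - 1"
  have m: "2 * n = Suc m" using n_pos by (simp add: m_def)
  \<comment> \<open>along the path, peaks and valleys in block \<open>v\<close> alternate, because no north step is followed by one of another block\<close>
  define g :: "nat \<Rightarrow> int" where
    "g = (\<lambda>k. if zeta ! k = North \<and> fst (key_list ! k) = v then -1 else 0)"
  have "int (card {k. k < m \<and> ?P k}) - int (card {k. k < m \<and> ?Q k}) = g m - g 0"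
  proof (rule card_diff_telescope)
    fix k assume "k < m"
    then have "fst (key_list ! k) = fst (key_list ! Suc k)" if "zeta ! k = North" "zeta ! Suc k = North"
      using that m by (intro level_double_north) auto
    then show "of_bool (?P k) - of_bool (?Q k) = g (Suc k) - g k"
      by (cases "zeta ! k"; cases "zeta ! Suc k") (simp_all add: g_def)
  qed
  also have "g m = 0" using north_not_last[of m] m by (auto simp: g_def)
  also have "g 0 = - of_bool (v = 0)" using zeta_first by (auto simp: g_def)
  finally show ?thesis using m by simp
qed

definition rises :: "nat set" where
  "rises = {i. 1 \<le> i \<and> i < n \<and> w (Suc i) = Suc (w i)}"

text \<open>By \<open>north_after_east\<close>, a valley joins the east step of a rise j to the
  north step of j + 1, whose block is w (j + 1).\<close>

lemma card_valleys:
  "card {k. Suc k < 2 * n \<and> zeta ! k = East \<and> zeta ! Suc k = North \<and> fst (key_list ! Suc k) = v}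
   = card {j \<in> rises. w (Suc j) = v}" (is "card ?A = card ?B")
proof -
  have A: "\<exists>p\<in>?B. k < 2 * n \<and> key_list ! k = east_key p" if k: "k \<in> ?A" for k
  proof -
    from k have k': "k < 2 * n" "Suc k < 2 * n" "zeta ! k = East" "zeta ! Suc k = North" by auto
    obtain p where p: "p \<in> {1..n}" "key_list ! k = east_key p"
      using zeta_East_obtain[OF k'(1,3)] .
    have "p \<in> ?B" using north_after_east[OF k'(2) p] k k' p by (auto simp: rises_def key_defs)
    then show ?thesis using p k' by blast
  qed
  have "inj_on (\<lambda>k. snd (key_list ! k)) ?A"
  proof (rule inj_onI)
    fix k l assume kl: "k \<in> ?A" "l \<in> ?A" "snd (key_list ! k) = snd (key_list ! l)"
    obtain p where p: "k < 2 * n" "key_list ! k = east_key p" using A[OF kl(1)] by blast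
    obtain q where q: "l < 2 * n" "key_list ! l = east_key q" using A[OF kl(2)] by blast
    have "key_list ! k = key_list ! l" using kl(3) by (simp add: p q key_defs)
    then show "k = l" by (rule key_list_nth_inj[OF p(1) q(1)])
  qed
  moreover have "(\<lambda>k. snd (key_list ! k)) ` ?A = ?B"
  proof (intro set_eqI iffI)
    fix p assume "p \<in> (\<lambda>k. snd (key_list ! k)) ` ?A"
    then obtain k where k: "k \<in> ?A" "p = snd (key_list ! k)" by (rule imageE)
    obtain q where "q \<in> ?B" "key_list ! k = east_key q" using A[OF k(1)] by blast
    then show "p \<in> ?B" using k(2) by (simp add: key_defs)
  next
    fix p assume p: "p \<in> ?B"
    then have p': "p \<in> {1..n}" "Suc p \<in> {1..n}" by (auto simp: rises_def)
    obtain k where k: "k < 2 * n" "key_list ! k = east_key p"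
      using ex_key_index[OF east_key_in[OF p'(1)]] .
    have "key_list ! k < north_key (Suc p)" using p k by (auto simp: key_defs rises_def)
    then have k1: "Suc k < 2 * n" using key_list_nth(4)[OF k(1)] p' by blast
    have "zeta ! Suc k = North" using north_after_east(1)[OF k1 p'(1) k(2)] p by (auto simp: rises_def)
    moreover from this have "key_list ! Suc k = north_key (Suc p)"
      using north_after_east(2)[OF k1 p'(1) k(2)] by simp
    moreover have "zeta ! k = East" using k by (simp add: zeta_nth)
    ultimately have "k \<in> ?A" "snd (key_list ! k) = p" using k k1 p by (auto simp: key_defs)
    then show "p \<in> (\<lambda>k. snd (key_list ! k)) ` ?A" by blast
  qed
  ultimately have "bij_betw (\<lambda>k. snd (key_list ! k)) ?A ?B" by (rule bij_betw_imageI)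
  then show ?thesis by (rule bij_betw_same_card)
qed

lemma card_peaks:
  "card {k. Suc k < 2 * n \<and> zeta ! k = North \<and> zeta ! Suc k = East \<and> fst (key_list ! k) = v}
   = card {i \<in> peak_rows zeta. bounce_word zeta i = v}" (is "card ?A = card ?B")
proof -
  have rows: "peak_rows zeta \<subseteq> {1..n}" by (auto simp: peak_rows_def count_zeta)
  have "inj_on (north_pos zeta) ?B"
    by (rule inj_on_subset[OF inj_on_north_pos]) (use rows in \<open>auto simp: count_zeta\<close>)
  moreover have "north_pos zeta ` ?B = ?A"
  proof (intro set_eqI iffI)
    fix k assume "k \<in> north_pos zeta ` ?B"
    then obtain i where i: "i \<in> peak_rows zeta" "bounce_word zeta i = v" "k = north_pos zeta i" by auto
    then have "i \<in> {1..n}" using rows by blast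
    then obtain p l where "p \<in> {1..n}" "i = row p" "l < 2 * n" "key_list ! l = north_key p"
      "north_pos zeta i = l" by (rule row_obtain)
    then have p: "p \<in> {1..n}" "i = row p" "k < 2 * n" "key_list ! k = north_key p"
      using i by auto
    then show "k \<in> ?A"
      using i north_key_index(1)[OF p(3,4)] bounce_word_zeta[OF p(1)] length_zeta
      by (auto simp: peak_rows_def key_defs)
  next
    fix k assume k: "k \<in> ?A"
    then have k': "k < 2 * n" "zeta ! k = North" by auto
    obtain p where p: "p \<in> {1..n}" "key_list ! k = north_key p" using zeta_North_obtain[OF k'] .
    have "row p \<in> ?B"
      using k p row_in[OF p(1)] north_key_index[OF k'(1) p(2)] bounce_word_zeta[OF p(1)] length_zeta
      by (auto simp: peak_rows_def key_defs count_zeta)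
    then show "k \<in> north_pos zeta ` ?B" using north_key_index(2)[OF k'(1) p(2)] by blast
  qed
  ultimately have "bij_betw (north_pos zeta) ?B ?A" by (rule bij_betw_imageI)
  then show ?thesis by (rule bij_betw_same_card[symmetric])
qed

text \<open>A positive letter is preceded by a letter smaller by one, whose east key is
  smaller.\<close>

lemma north_col_zeta_eq_0:
  assumes "i \<in> {1..n}"
  shows "north_col zeta i = 0 \<longleftrightarrow> bounce_word zeta i = 0"
proof -
  obtain p k where p: "p \<in> {1..n}" "i = row p" "k < 2 * n" "key_list ! k = north_key p"
    by (rule row_obtain[OF assms])
  have "north_col zeta i = 0 \<longleftrightarrow> {q \<in> {1..n}. east_key q < north_key p} = {}"
    unfolding p(2) north_key_index(3)[OF p(3,4)] by (subst card_0_eq) auto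
  also have "\<dots> \<longleftrightarrow> w p = 0"
  proof
    assume empty: "{q \<in> {1..n}. east_key q < north_key p} = {}"
    show "w p = 0"
    proof (rule ccontr)
      assume "w p \<noteq> 0"
      then obtain q where "1 \<le> q" "q < p" "w q = w p - 1"
        using ex_previous_value[of p "w p - 1"] p by auto
      then have "q \<in> {q \<in> {1..n}. east_key q < north_key p}"
        using p \<open>w p \<noteq> 0\<close> by (auto simp: key_defs)
      then show False using empty by blast
    qed
  qed (auto simp: key_defs)
  finally show ?thesis using p bounce_word_zeta by simp
qed

text \<open>Column 0 and block 0 consist of the same rows. Block 0 has one more peak than valleys,
  and no valley since a rise ends in a positive letter; so the definite description in
  \<open>first_peak\<close> has a unique solution.\<close>

lemma
  shows first_peak_zeta: "first_peak zeta \<in> {1..n}" "bounce_word zeta (first_peak zeta) = 0"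
    and peaks_label_0: "{i \<in> peak_rows zeta. bounce_word zeta i = 0} = {first_peak zeta}"
proof -
  have rows: "peak_rows zeta \<subseteq> {1..n}" by (auto simp: peak_rows_def count_zeta)
  have "{j \<in> rises. w (Suc j) = 0} = {}" by (auto simp: rises_def)
  then have "card {i \<in> peak_rows zeta. bounce_word zeta i = 0} = 1"
    using card_peaks_minus_valleys[of 0] unfolding card_peaks card_valleys
    by (simp only: of_bool_eq card.empty) simp
  then obtain i where i: "{i \<in> peak_rows zeta. bounce_word zeta i = 0} = {i}"
    by (auto simp: card_1_singleton_iff)
  moreover have "{i \<in> peak_rows zeta. bounce_word zeta i = 0} = {i \<in> peak_rows zeta. north_col zeta i = 0}"
    using north_col_zeta_eq_0 subsetD[OF rows] by (intro Collect_cong conj_cong refl) auto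
  ultimately have "{i \<in> peak_rows zeta. north_col zeta i = 0} = {i}" by (simp only:)
  then have *: "j \<in> peak_rows zeta \<and> north_col zeta j = 0 \<longleftrightarrow> j = i" for j
    unfolding set_eq_iff mem_Collect_eq singleton_iff by (rule spec)
  have "first_peak zeta = i" unfolding first_peak_def * by (rule the_eq_trivial)
  with i show eq: "{i \<in> peak_rows zeta. bounce_word zeta i = 0} = {first_peak zeta}" by simp
  then have "first_peak zeta \<in> {i \<in> peak_rows zeta. bounce_word zeta i = 0}" by (simp only: singletonI)
  then have mem: "first_peak zeta \<in> peak_rows zeta" "bounce_word zeta (first_peak zeta) = 0"
    by (simp_all only: mem_Collect_eq)
  from subsetD[OF rows mem(1)] mem(2)
  show "first_peak zeta \<in> {1..n}" "bounce_word zeta (first_peak zeta) = 0" .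
qed

text \<open>This supplies the bijection for decorated rises: a decorated rise j costs the area
  letter at j + 1, a decorated peak of the image costs its bounce label.\<close>

lemma card_rises_by_label:
  "card {j \<in> rises. w (Suc j) = v} = card {i \<in> peak_rows zeta - {first_peak zeta}. bounce_word zeta i = v}"
proof (cases "v = 0")
  case True
  have "{i \<in> peak_rows zeta - {first_peak zeta}. bounce_word zeta i = v} = {}"
    using peaks_label_0 True by blast
  moreover have "{j \<in> rises. w (Suc j) = v} = {}" using True by (auto simp: rises_def)
  ultimately show ?thesis by (simp only:)
next
  case False
  have "{i \<in> peak_rows zeta - {first_peak zeta}. bounce_word zeta i = v} = {i \<in> peak_rows zeta. bounce_word zeta i = v}"
    using first_peak_zeta(2) False by auto
  then show ?thesis
    using card_peaks_minus_valleys[of v] False unfolding card_peaks card_valleys by simp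
qed

text \<open>The pairs that dinv loses when p is decorated: a pair of equal letters is charged to its
  left member, a pair with w i = w j + 1 to its right member j.\<close>

definition weight :: "nat \<Rightarrow> nat" where
  "weight p = card {q \<in> {1..n}. p < q \<and> w q = w p} + card {q \<in> {1..n}. q < p \<and> w q = Suc (w p)}"

text \<open>The height counts the letters whose north step, but not whose east step, has been
  read.\<close>

lemma height_after_east:
  assumes "p \<in> {1..n}" "k < 2 * n" "key_list ! k = east_key p"
  shows "height zeta (Suc k) = int (weight p)"
proof -
  let ?A = "{q \<in> {1..n}. north_key q < east_key p}"
  \<comment> \<open>The comparison is weak because the east step of p itself has been read.\<close>
  let ?B = "{q \<in> {1..n}. east_key q \<le> east_key p}"
  have E: "zeta ! k = East" using assms by (simp add: zeta_nth)
  have "?B = insert p {q \<in> {1..n}. east_key q < east_key p}"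
    using assms(1) by (auto simp: key_defs less_prod_def less_eq_prod_def)
  then have "card ?B = Suc (card {q \<in> {1..n}. east_key q < east_key p})" by simp
  then have "height zeta (Suc k) = int (card ?A) - int (card ?B)"
    using assms E by (simp add: height_def count_list_take_Suc length_zeta count_take_zeta)
  also have "?B \<subseteq> ?A" by (auto simp: key_defs less_prod_def less_eq_prod_def)
  then have "int (card ?A) - int (card ?B) = int (card (?A - ?B))"
    by (simp add: card_Diff_subset card_mono)
  also have "?A - ?B = {q \<in> {1..n}. p < q \<and> w q = w p} \<union> {q \<in> {1..n}. q < p \<and> w q = Suc (w p)}"
    by (auto simp: key_defs less_prod_def less_eq_prod_def le_Suc_eq not_less Suc_le_eq)
  also have "card \<dots> = weight p"
    unfolding weight_def by (intro card_Un_disjoint) auto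
  finally show ?thesis .
qed

text \<open>The lexicographic maximum selects the rightmost letter of maximal value;
  \<open>rightmost_highest_peak_eq\<close> identifies it with the distinguished peak.\<close>

definition top_row :: nat where
  "top_row = snd (Max (north_key ` {1..n}))"

lemma top_row: "top_row \<in> {1..n}" "p \<in> {1..n} \<Longrightarrow> north_key p \<le> north_key top_row"
proof -
  have "Max (north_key ` {1..n}) \<in> north_key ` {1..n}" using n_pos by (intro Max_in) auto
  then obtain r where r: "r \<in> {1..n}" "Max (north_key ` {1..n}) = north_key r" by auto
  then have "top_row = r" by (simp add: top_row_def key_defs)
  then show "top_row \<in> {1..n}" using r by simp
  show "north_key p \<le> north_key top_row" if "p \<in> {1..n}"
    unfolding \<open>top_row = r\<close> r(2)[symmetric] using that by (intro Max_ge) auto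
qed

lemma top_row_not_rise: "top_row \<notin> rises"
  using top_row(2)[of "Suc top_row"] by (auto simp: rises_def key_defs)

text \<open>East keys are ordered like north keys, and each north key lies below an east key, so the
  largest of all keys is the east key of \<open>top_row\<close>.\<close>

lemma east_key_last_iff:
  assumes "p \<in> {1..n}" "k < 2 * n" "key_list ! k = east_key p"
  shows "Suc k < 2 * n \<longleftrightarrow> p \<noteq> top_row"
proof
  assume k: "Suc k < 2 * n"
  have less: "east_key p < key_list ! Suc k" using key_list_nth(2)[OF assms(2) k] assms by simp
  have "\<exists>q\<in>{1..n}. east_key p < east_key q"
    using key_list_nth(6)[OF k]
  proof (cases rule: key_cases)
    case (1 q)
    then have "north_key q < east_key q" by (simp add: key_defs)
    then show ?thesis using 1 less by (intro bexI[of _ q]) auto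
  next
    case (2 q)
    then show ?thesis using less by auto
  qed
  then obtain q where "q \<in> {1..n}" "north_key p < north_key q"
    unfolding key_defs less_prod_def by force
  then show "p \<noteq> top_row" using top_row(2)[of q] by auto
next
  assume "p \<noteq> top_row"
  then have "north_key p < north_key top_row"
    using top_row(2)[OF assms(1)] by (auto simp: key_defs less_prod_def less_eq_prod_def)
  then have "key_list ! k < east_key top_row"
    using assms by (auto simp: key_defs less_prod_def)
  then show "Suc k < 2 * n" using key_list_nth(4)[OF assms(2)] top_row(1) by blast
qed

text \<open>For a peak p other than \<open>top_row\<close> some step follows the east step of p, and
  by \<open>north_after_east\<close> it is not a north step.\<close>

lemma card_double_east:
  "card {k. Suc k < 2 * n \<and> zeta ! k = East \<and> zeta ! Suc k = East \<and> height zeta (Suc k) = int d}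
   = card {p \<in> {1..n} - rises - {top_row}. weight p = d}" (is "card ?A = card ?B")
proof -
  have A: "\<exists>p\<in>?B. k < 2 * n \<and> key_list ! k = east_key p" if k: "k \<in> ?A" for k
  proof -
    from k have k': "k < 2 * n" "Suc k < 2 * n" "zeta ! k = East" "zeta ! Suc k = East" by auto
    obtain p where p: "p \<in> {1..n}" "key_list ! k = east_key p"
      using zeta_East_obtain[OF k'(1,3)] .
    have "p \<in> ?B"
      using north_after_east(1)[OF k'(2) p] east_key_last_iff[OF p(1) k'(1) p(2)]
        height_after_east[OF p(1) k'(1) p(2)] k k' p by (auto simp: rises_def)
    then show ?thesis using p k' by blast
  qed
  have "inj_on (\<lambda>k. snd (key_list ! k)) ?A"
  proof (rule inj_onI)
    fix k l assume kl: "k \<in> ?A" "l \<in> ?A" "snd (key_list ! k) = snd (key_list ! l)"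
    obtain p where p: "k < 2 * n" "key_list ! k = east_key p" using A[OF kl(1)] by blast
    obtain q where q: "l < 2 * n" "key_list ! l = east_key q" using A[OF kl(2)] by blast
    have "key_list ! k = key_list ! l" using kl(3) by (simp add: p q key_defs)
    then show "k = l" by (rule key_list_nth_inj[OF p(1) q(1)])
  qed
  moreover have "(\<lambda>k. snd (key_list ! k)) ` ?A = ?B"
  proof (intro set_eqI iffI)
    fix p assume "p \<in> (\<lambda>k. snd (key_list ! k)) ` ?A"
    then obtain k where k: "k \<in> ?A" "p = snd (key_list ! k)" by (rule imageE)
    obtain q where "q \<in> ?B" "key_list ! k = east_key q" using A[OF k(1)] by blast
    then show "p \<in> ?B" using k(2) by (simp add: key_defs)
  next
    fix p assume p: "p \<in> ?B"
    then have p': "p \<in> {1..n}" by auto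
    obtain k where k: "k < 2 * n" "key_list ! k = east_key p"
      using ex_key_index[OF east_key_in[OF p']] .
    have k1: "Suc k < 2 * n" using east_key_last_iff[OF p' k] p by simp
    have "zeta ! Suc k = East"
      using north_after_east(1)[OF k1 p' k(2)] p p' not_North_iff by (auto simp: rises_def)
    moreover have "zeta ! k = East" using k by (simp add: zeta_nth)
    ultimately have "k \<in> ?A" "snd (key_list ! k) = p"
      using k k1 p height_after_east[OF p' k] by (auto simp: key_defs)
    then show "p \<in> (\<lambda>k. snd (key_list ! k)) ` ?A" by blast
  qed
  ultimately have "bij_betw (\<lambda>k. snd (key_list ! k)) ?A ?B" by (rule bij_betw_imageI)
  then show ?thesis by (rule bij_betw_same_card)
qed

text \<open>Chains three counts in the image: peaks give double east steps, these are as many as the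
  double north steps at the same height, and the latter are rises.\<close>

lemma card_peaks_by_weight:
  "card {p \<in> {1..n} - rises - {top_row}. weight p = d} = card {j \<in> rise_rows zeta. area_word zeta (Suc j) = d}"
  using card_rises_area[OF dyck_path_zeta] card_double_steps[OF dyck_path_zeta] card_double_east
  by (simp add: length_zeta)

end

section \<open>Double counting and fibrewise bijections\<close>

lemma card_double_count:
  fixes R :: "nat \<Rightarrow> nat \<Rightarrow> bool"
  assumes "finite I"
  shows "(\<Sum>p\<in>I. card {q \<in> I. R q p}) = (\<Sum>p\<in>I. card {q \<in> I. R p q})"
proof -
  have "(\<Sum>p\<in>I. card {q \<in> I. R q p}) = (\<Sum>p\<in>I. \<Sum>q\<in>I. of_bool (R q p))"
    using assms by (simp add: Collect_conj_eq)
  also have "\<dots> = (\<Sum>q\<in>I. \<Sum>p\<in>I. of_bool (R q p))" by (rule sum.swap)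
  also have "\<dots> = (\<Sum>p\<in>I. card {q \<in> I. R p q})"
    using assms by (simp add: Collect_conj_eq)
  finally show ?thesis .
qed

text \<open>Bijections between the fibres over each value d are chosen and glued along f.\<close>

lemma ex_bij_betw_preserving:
  assumes fin: "finite A" "finite B"
    and card: "\<And>d. card {x \<in> A. f x = d} = card {y \<in> B. g y = d}"
  shows "\<exists>h. bij_betw h A B \<and> (\<forall>x\<in>A. g (h x) = f x)"
proof -
  have "\<forall>d. \<exists>h. bij_betw h {x \<in> A. f x = d} {y \<in> B. g y = d}"
    using fin card by (intro allI finite_same_card_bij) auto
  then obtain H where H: "bij_betw (H d) {x \<in> A. f x = d} {y \<in> B. g y = d}" for d by metis
  define h where "h x = H (f x) x" for x
  have h: "h x \<in> B" "g (h x) = f x" if "x \<in> A" for x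
    using bij_betwE[OF H[of "f x"]] that by (auto simp: h_def)
  have "inj_on h A"
  proof (rule inj_onI)
    fix x y assume xy: "x \<in> A" "y \<in> A" "h x = h y"
    then have "f x = f y" using h(2) by metis
    then show "x = y"
      using xy bij_betw_imp_inj_on[OF H[of "f x"]] by (auto simp: h_def inj_on_def)
  qed
  moreover have "h ` A = B"
  proof
    show "h ` A \<subseteq> B" using h by auto
    show "B \<subseteq> h ` A"
    proof
      fix y assume "y \<in> B"
      then have "y \<in> H (g y) ` {x \<in> A. f x = g y}" using bij_betw_imp_surj_on[OF H[of "g y"]] by simp
      then obtain x where "x \<in> A" "f x = g y" "y = H (g y) x" by blast
      then have "y = h x" by (simp add: h_def)
      with \<open>x \<in> A\<close> show "y \<in> h ` A" by blast
    qed
  qed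
  ultimately show ?thesis using h(2) unfolding bij_betw_def by blast
qed

section \<open>Area, bounce and dinv under the zeta map\<close>

context area_seq
begin

text \<open>\<open>area_word_zeta\<close> assigns each pair of letters to the member opposite to the
  one used by \<open>weight\<close>; double counting reconciles the totals.\<close>

lemma sum_area_word_zeta: "(\<Sum>i=1..n. area_word zeta i) = (\<Sum>p=1..n. weight p)"
proof -
  have "(\<Sum>i=1..n. area_word zeta i) = (\<Sum>p=1..n. area_word zeta (row p))"
    using sum.reindex_bij_betw[OF bij_betw_row, of "area_word zeta"] by simp
  also have "\<dots> = (\<Sum>p=1..n. card {q \<in> {1..n}. q < p \<and> w q = w p}) +
      (\<Sum>p=1..n. card {q \<in> {1..n}. p < q \<and> w p = Suc (w q)})"
    unfolding sum.distrib[symmetric] by (intro sum.cong refl area_word_zeta)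
  also have "\<dots> = (\<Sum>p=1..n. card {q \<in> {1..n}. p < q \<and> w p = w q}) +
      (\<Sum>p=1..n. card {q \<in> {1..n}. q < p \<and> w q = Suc (w p)})"
    using card_double_count[of "{1..n}" "\<lambda>q p. q < p \<and> w q = w p"]
      card_double_count[of "{1..n}" "\<lambda>q p. q < p \<and> w q = Suc (w p)"] by simp
  also have "\<dots> = (\<Sum>p=1..n. weight p)"
    unfolding sum.distrib[symmetric] weight_def
    by (intro sum.cong refl arg_cong2[of _ _ _ _ "(+)"] arg_cong[of _ _ card]) auto
  finally show ?thesis .
qed

lemma sum_bounce_word_zeta: "(\<Sum>i=1..n. bounce_word zeta i) = (\<Sum>p=1..n. w p)"
  using sum.reindex_bij_betw[OF bij_betw_row, of "bounce_word zeta"] bounce_word_zeta by simp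

text \<open>Every pair is listed under the letter whose decoration would delete it, so pairs of the
  second kind appear swapped in \<open>?B\<close>.\<close>

lemma card_dinv_pairs:
  "card {(i, j). 1 \<le> i \<and> i < j \<and> j \<le> n \<and> (w i = w j \<and> i \<notin> P \<or> w i = w j + 1 \<and> j \<notin> P)}
    = (\<Sum>p\<in>{1..n} - P. weight p)" (is "card ?S = _")
proof -
  let ?A = "SIGMA i:{1..n} - P. {q \<in> {1..n}. i < q \<and> w q = w i}"
  let ?B = "SIGMA j:{1..n} - P. {q \<in> {1..n}. q < j \<and> w q = Suc (w j)}"
  have "(i, j) \<in> ?S \<longleftrightarrow> (i, j) \<in> ?A \<or> (j, i) \<in> ?B" for i j
  proof -
    have "(i, j) \<in> ?A \<longleftrightarrow> 1 \<le> i \<and> i < j \<and> j \<le> n \<and> w i = w j \<and> i \<notin> P" by auto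
    moreover have "(j, i) \<in> ?B \<longleftrightarrow> 1 \<le> i \<and> i < j \<and> j \<le> n \<and> w i = w j + 1 \<and> j \<notin> P" by auto
    ultimately show ?thesis unfolding mem_Collect_eq case_prod_conv by blast
  qed
  then have mem: "x \<in> ?S \<longleftrightarrow> x \<in> ?A \<or> prod.swap x \<in> ?B" for x
    by (cases x) (simp only: prod.swap_def fst_conv snd_conv)
  have "y \<in> prod.swap ` B \<longleftrightarrow> prod.swap y \<in> B" for y :: "nat \<times> nat" and B
    by (cases y) simp
  with mem have S: "?S = ?A \<union> prod.swap ` ?B" by (intro set_eqI) (simp only: Un_iff)
  have "card ?S = card ?A + card (prod.swap ` ?B)"
    unfolding S by (intro card_Un_disjoint finite_imageI finite_SigmaI) auto
  also have "\<dots> = card ?A + card ?B"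
    by (simp only: card_image[OF inj_swap])
  also have "\<dots> = (\<Sum>p\<in>{1..n} - P. weight p)"
    by (simp add: weight_def sum.distrib)
  finally show ?thesis .
qed

section \<open>Injectivity\<close>

lemma length_initial_segment:
  assumes "l < 2 * n"
  shows "card {x \<in> keys. x < key_list ! l} = l"
proof -
  have "distinct (take l key_list)" by (simp add: key_list_def)
  then show ?thesis
    using distinct_card[of "take l key_list"] key_list_nth(1)[OF assms] assms
    by (simp add: length_key_list)
qed

lemma card_keys_less:
  "card {x \<in> keys. x < y} = card {q \<in> {1..n}. north_key q < y} + card {q \<in> {1..n}. east_key q < y}"
proof -
  have "{x \<in> keys. x < y} = {x \<in> keys. x < y \<and> step_of x = North} \<union> {x \<in> keys. x < y \<and> step_of x = East}"
    using not_North_iff by blast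
  moreover have "card ({x \<in> keys. x < y \<and> step_of x = North} \<union> {x \<in> keys. x < y \<and> step_of x = East}) =
      card {x \<in> keys. x < y \<and> step_of x = North} + card {x \<in> keys. x < y \<and> step_of x = East}"
    by (intro card_Un_disjoint) (auto simp: finite_keys)
  ultimately show ?thesis by (simp only: card_north card_east)
qed

text \<open>The right-hand side involves only the numbers of letters below a value and the letters
  before p, so it can be compared for two words; \<open>(Suc c, p)\<close> may fail to be a
  key.\<close>

lemma card_keys_below:
  "card {x \<in> keys. x < (Suc c, p)} =
    card {q \<in> {1..n}. w q < Suc c} + card {q \<in> {1..n}. q < p \<and> w q = Suc c} +
    (card {q \<in> {1..n}. w q < c} + card {q \<in> {1..n}. q < p \<and> w q = c})"
proof -
  have "{q \<in> {1..n}. north_key q < (Suc c, p)} =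
      {q \<in> {1..n}. w q < Suc c} \<union> {q \<in> {1..n}. q < p \<and> w q = Suc c}"
    by (auto simp: key_defs)
  moreover have "{q \<in> {1..n}. east_key q < (Suc c, p)} =
      {q \<in> {1..n}. w q < c} \<union> {q \<in> {1..n}. q < p \<and> w q = c}"
    by (auto simp: key_defs)
  moreover have "card ({q \<in> {1..n}. w q < d} \<union> {q \<in> {1..n}. q < p \<and> w q = d}) =
      card {q \<in> {1..n}. w q < d} + card {q \<in> {1..n}. q < p \<and> w q = d}" for d
    by (intro card_Un_disjoint) auto
  ultimately show ?thesis by (simp only: card_keys_less)
qed

text \<open>Recovers the multiplicities of the letters from the returns of the bounce path.\<close>

lemma card_value:
  "card {q \<in> {1..n}. w q < Suc m} = card {q \<in> {1..n}. w q < m} + card {q \<in> {1..n}. w q = m}"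
proof -
  have "{q \<in> {1..n}. w q < Suc m} = {q \<in> {1..n}. w q < m} \<union> {q \<in> {1..n}. w q = m}" by auto
  moreover have "card ({q \<in> {1..n}. w q < m} \<union> {q \<in> {1..n}. w q = m}) =
      card {q \<in> {1..n}. w q < m} + card {q \<in> {1..n}. w q = m}"
    by (intro card_Un_disjoint) auto
  ultimately show ?thesis by (simp only:)
qed

text \<open>Let two words agree before position \<open>p\<close> and let the second, but not the first, have the
  letter \<open>c + 1\<close> there. The image of the second word then has a north step at the position \<open>l\<close>
  below. The first word, if it has the letter \<open>c + 1\<close> later on, must attain \<open>c\<close> before, so that its
  image has an east step at \<open>l\<close>.\<close>

lemma east_at_first_gap:
  assumes p: "p \<in> {1..n}" "w p < Suc c" and q: "q \<in> {1..n}" "p \<le> q" "w q = Suc c"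
    and l: "l < 2 * n" "card {x \<in> keys. x < (Suc c, p)} = l"
  shows "zeta ! l = East"
proof (rule ccontr)
  assume "zeta ! l \<noteq> East"
  then have "zeta ! l = North" using not_North_iff by blast
  then obtain s where s: "s \<in> {1..n}" "key_list ! l = north_key s" by (rule zeta_North_obtain[OF l(1)])
  let ?X = "{x \<in> keys. x < north_key s}" and ?Y = "{x \<in> keys. x < (Suc c, p)}"
  \<comment> \<open>Both sets are initial segments of the keys, hence nested, and equal size makes
    them equal.\<close>
  have "card ?X = card ?Y" using length_initial_segment[OF l(1)] l(2) s by simp
  moreover have "{x \<in> keys. x < a} \<subseteq> {x \<in> keys. x < b}" if "a \<le> b" for a b
    using less_le_trans[OF _ that] by blast
  then have "?X \<subseteq> ?Y \<or> ?Y \<subseteq> ?X" using linear[of "north_key s" "(Suc c, p)"] by blast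
  ultimately have "?X = ?Y" using finite_keys card_subset_eq[of ?Y ?X] card_subset_eq[of ?X ?Y] by auto
  then have eq: "x < north_key s \<longleftrightarrow> x < (Suc c, p)" if "x \<in> keys" for x using that by blast
  have "(Suc c, p) \<le> north_key s" using eq[OF north_key_in[OF s(1)]] by (simp add: not_less)
  moreover have "\<not> north_key q < north_key s"
    using eq[OF north_key_in[OF q(1)]] q by (simp add: key_defs)
  then have "north_key s \<le> north_key q" by (simp only: not_less)
  ultimately have "w s = Suc c" "p \<le> s" using q(3) by (auto simp: key_defs)
  then have "p < s" using p by (cases "p = s") auto
  \<comment> \<open>The last letter c before s lies at p or later, because w p is at most c. Its
    east key is below \<open>north_key s\<close> but not below \<open>(Suc c, p)\<close>.\<close>
  obtain r where r: "1 \<le> r" "r < s" "w r = c" "\<And>t. r < t \<Longrightarrow> t \<le> s \<Longrightarrow> c < w t"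
    using ex_previous_value[of s c] s \<open>w s = Suc c\<close> by auto
  have "p \<le> r" using r(4)[of p] \<open>p < s\<close> p by force
  moreover have "east_key r < (Suc c, p)"
    using eq[OF east_key_in[of r]] r s \<open>w s = Suc c\<close> by (simp add: key_defs)
  ultimately show False using r(3) by (simp add: key_defs)
qed

end

text \<open>Equal images have equal bounce returns, so both words use each letter equally often.
  Then equally many keys precede \<open>(Suc c, p)\<close> in both, and at this index one image goes
  north and the other east.\<close>

lemma zeta_neq:
  assumes A: "area_seq n w" and B: "area_seq n w'" and p: "p \<in> {1..n}"
    and agree: "\<And>q. q \<in> {1..n} \<Longrightarrow> q < p \<Longrightarrow> w q = w' q"
    and less: "w p < w' p"
  shows "area_seq.zeta n w \<noteq> area_seq.zeta n w'"
proof
  assume eq: "area_seq.zeta n w = area_seq.zeta n w'"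
  interpret A: area_seq n w by (rule A)
  interpret B: area_seq n w' by (rule B)
  obtain c where c: "w' p = Suc c" using less by (cases "w' p") auto
  have below: "card {q \<in> {1..n}. w q < m} = card {q \<in> {1..n}. w' q < m}" for m
    using A.bounce_return_zeta[of m] B.bounce_return_zeta[of m] eq by simp
  have prefix: "{q \<in> {1..n}. q < p \<and> w q = d} = {q \<in> {1..n}. q < p \<and> w' q = d}" for d
    using agree by auto
  have keys: "card {x \<in> A.keys. x < (Suc c, p)} = card {x \<in> B.keys. x < (Suc c, p)}"
    unfolding A.card_keys_below B.card_keys_below below prefix ..
  obtain l where l: "l < 2 * n" "B.key_list ! l = B.north_key p"
    using B.ex_key_index[OF B.north_key_in[OF p]] .
  have North: "B.zeta ! l = North" by (rule B.north_key_index(1)[OF l])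
  have card: "card {x \<in> A.keys. x < (Suc c, p)} = l"
    using B.length_initial_segment[OF l(1)] l(2) c keys by (simp add: B.north_key_def)
  \<comment> \<open>The letter Suc c is equally frequent in both words, which agree before p. The
    second word has one at p, so the first has one at p or later.\<close>
  have "\<exists>q\<in>{1..n}. p \<le> q \<and> w q = Suc c"
  proof (rule ccontr)
    assume "\<not> ?thesis"
    then have "{q \<in> {1..n}. w q = Suc c} = {q \<in> {1..n}. q < p \<and> w' q = Suc c}"
      unfolding prefix[symmetric] by (auto simp flip: not_le)
    also have "\<dots> \<subset> {q \<in> {1..n}. w' q = Suc c}" using p c by auto
    finally have "card {q \<in> {1..n}. w q = Suc c} < card {q \<in> {1..n}. w' q = Suc c}"
      by (intro psubset_card_mono) auto
    then show False using A.card_value[of "Suc c"] B.card_value[of "Suc c"] below by simp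
  qed
  then obtain q where "q \<in> {1..n}" "p \<le> q" "w q = Suc c" by blast
  then have "A.zeta ! l = East" using A.east_at_first_gap[OF p _ _ _ _ l(1) card] less c by simp
  then show False using North eq by simp
qed

lemma zeta_inj:
  assumes A: "area_seq n w" and B: "area_seq n w'"
    and eq: "area_seq.zeta n w = area_seq.zeta n w'" and p: "p \<in> {1..n}"
  shows "w p = w' p"
  using p
proof (induction p rule: less_induct)
  case (less p)
  then have agree: "w q = w' q" if "q \<in> {1..n}" "q < p" for q using that by blast
  have "\<not> w p < w' p" using zeta_neq[OF A B less.prems agree] eq by blast
  moreover have "\<not> w' p < w p" using zeta_neq[OF B A less.prems agree[symmetric]] eq by metis
  ultimately show ?case by simp
qed

section \<open>The zeta map on Dyck paths\<close>

lemma area_seq_area_word: "dyck_path n D \<Longrightarrow> 1 \<le> n \<Longrightarrow> area_seq n (area_word D)"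
  by unfold_locales (use area_word_first area_word_Suc_le in auto)

definition zeta_path :: "step list \<Rightarrow> step list" where
  "zeta_path D = area_seq.zeta (count_list D North) (area_word D)"

lemma bij_betw_zeta_path:
  assumes "1 \<le> n"
  shows "bij_betw zeta_path {D. dyck_path n D} {D. dyck_path n D}"
proof -
  have zeta: "zeta_path D = area_seq.zeta n (area_word D)" if "dyck_path n D" for D
    using dyck_pathD(1)[OF that] by (simp add: zeta_path_def)
  have "inj_on zeta_path {D. dyck_path n D}"
  proof (rule inj_onI)
    fix D D' assume "D \<in> {D. dyck_path n D}" "D' \<in> {D. dyck_path n D}" and eq: "zeta_path D = zeta_path D'"
    then have D: "dyck_path n D" "dyck_path n D'" by auto
    then show "D = D'"
      using zeta_inj[OF area_seq_area_word[OF D(1) assms] area_seq_area_word[OF D(2) assms]] eq zeta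
      by (intro dyck_path_eqI[OF D]) simp
  qed
  moreover have "zeta_path ` {D. dyck_path n D} \<subseteq> {D. dyck_path n D}"
    using zeta area_seq.dyck_path_zeta[OF area_seq_area_word] assms by auto
  ultimately show ?thesis
    using endo_inj_surj[OF finite_dyck_paths] by (auto simp: bij_betw_def)
qed

text \<open>A letter of maximal value cannot start a rise, so the maximum over all rows is attained
  at a peak.\<close>

lemma rightmost_highest_peak_eq:
  assumes D: "dyck_path n D" and n: "1 \<le> n"
  shows "rightmost_highest_peak D = area_seq.top_row n (area_word D)"
proof -
  interpret area_seq n "area_word D" by (rule area_seq_area_word[OF D n])
  have rises: "rise_rows D = rises" using rise_rows_area_word[OF D] by (simp add: rises_def)
  have peaks: "peak_rows D = {1..n} - rises" using peak_rows_conv_rise[OF D] rises by simp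
  have top: "top_row \<in> peak_rows D" using top_row(1) top_row_not_rise peaks by simp
  have le: "area_word D j \<le> area_word D top_row" if "j \<in> {1..n}" for j
    using top_row(2)[OF that] by (auto simp: key_defs)
  show ?thesis
    unfolding rightmost_highest_peak_def
  proof (rule Max_eqI)
    show "finite {i \<in> peak_rows D. \<forall>j\<in>peak_rows D. area_word D j \<le> area_word D i}" by (simp add: peaks)
    show "top_row \<in> {i \<in> peak_rows D. \<forall>j\<in>peak_rows D. area_word D j \<le> area_word D i}"
      using top le peaks by auto
  next
    fix i assume "i \<in> {i \<in> peak_rows D. \<forall>j\<in>peak_rows D. area_word D j \<le> area_word D i}"
    then have i: "i \<in> {1..n}" "area_word D top_row \<le> area_word D i" using top peaks by auto
    then show "i \<le> top_row" using top_row(2)[OF i(1)] by (auto simp: key_defs)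
  qed
qed

section \<open>Moving the decorations\<close>

lemma decoration_bijections:
  assumes D: "dyck_path n D" and n: "1 \<le> n"
  obtains \<phi> \<psi> where
    "bij_betw \<phi> (peak_rows D - {rightmost_highest_peak D}) (rise_rows (zeta_path D))"
    "bij_betw \<psi> (rise_rows D) (peak_rows (zeta_path D) - {first_peak (zeta_path D)})"
    "\<And>p. p \<in> peak_rows D - {rightmost_highest_peak D} \<Longrightarrow>
       area_word (zeta_path D) (Suc (\<phi> p)) = area_seq.weight n (area_word D) p"
    "\<And>j. j \<in> rise_rows D \<Longrightarrow> bounce_word (zeta_path D) (\<psi> j) = area_word D (Suc j)"
proof -
  interpret area_seq n "area_word D" by (rule area_seq_area_word[OF D n])
  have zeta: "zeta_path D = zeta" using dyck_pathD(1)[OF D] by (simp add: zeta_path_def)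
  have rises: "rise_rows D = rises" using rise_rows_area_word[OF D] by (simp add: rises_def)
  have peaks: "peak_rows D - {rightmost_highest_peak D} = {1..n} - rises - {top_row}"
    using peak_rows_conv_rise[OF D] rises rightmost_highest_peak_eq[OF D n] by simp
  have fin: "finite (peak_rows E)" "finite (rise_rows E)" for E
    by (simp_all add: peak_rows_def rise_rows_def)
  obtain \<phi> where "bij_betw \<phi> ({1..n} - rises - {top_row}) (rise_rows zeta)"
    "\<forall>p \<in> {1..n} - rises - {top_row}. area_word zeta (Suc (\<phi> p)) = weight p"
    using ex_bij_betw_preserving[of "{1..n} - rises - {top_row}" "rise_rows zeta" weight "\<lambda>j. area_word zeta (Suc j)"]
      card_peaks_by_weight fin by auto
  moreover obtain \<psi> where "bij_betw \<psi> rises (peak_rows zeta - {first_peak zeta})"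
    "\<forall>j \<in> rises. bounce_word zeta (\<psi> j) = area_word D (Suc j)"
    using ex_bij_betw_preserving[of rises "peak_rows zeta - {first_peak zeta}" "\<lambda>j. area_word D (Suc j)" "bounce_word zeta"]
      card_rises_by_label fin(2)[of D] fin(1)[of zeta] rises by auto
  ultimately show thesis by (intro that[of \<phi> \<psi>]) (simp_all only: zeta rises peaks)
qed


theorem theorem2p3:
  fixes n a b :: nat
  assumes "n \<ge> 1"
  shows "\<exists>\<zeta>. bij_betw \<zeta> (decorated_dyck_paths_tilde n a b) (decorated_dyck_paths_hat n b a) \<and>
    (\<forall>D \<in> decorated_dyck_paths_tilde n a b.
       area D = int (bounce (\<zeta> D)) \<and> int (dinv D) = area (\<zeta> D))"
proof -
  let ?P = "\<lambda>D. peak_rows D - {rightmost_highest_peak D}"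
  let ?P' = "\<lambda>D. peak_rows D - {first_peak D}"
  \<comment> \<open>Both bijections are bundled in a pair, so that one choice per undecorated path
    fixes them together.\<close>
  define good where "good D F \<longleftrightarrow>
      bij_betw (fst F) (?P D) (rise_rows (zeta_path D)) \<and>
      bij_betw (snd F) (rise_rows D) (?P' (zeta_path D)) \<and>
      (\<forall>p \<in> ?P D. area_word (zeta_path D) (Suc (fst F p)) = area_seq.weight n (area_word D) p) \<and>
      (\<forall>j \<in> rise_rows D. bounce_word (zeta_path D) (snd F j) = area_word D (Suc j))"
    for D and F :: "(nat \<Rightarrow> nat) \<times> (nat \<Rightarrow> nat)"
  have "\<exists>F. good D F" if D: "dyck_path n D" for D
  proof (rule decoration_bijections[OF D assms])
    fix \<phi> \<psi>
    assume "bij_betw \<phi> (?P D) (rise_rows (zeta_path D))" "bij_betw \<psi> (rise_rows D) (?P' (zeta_path D))"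
      "\<And>p. p \<in> ?P D \<Longrightarrow> area_word (zeta_path D) (Suc (\<phi> p)) = area_seq.weight n (area_word D) p"
      "\<And>j. j \<in> rise_rows D \<Longrightarrow> bounce_word (zeta_path D) (\<psi> j) = area_word D (Suc j)"
    then have "good D (\<phi>, \<psi>)" by (simp add: good_def)
    then show ?thesis by blast
  qed
  then obtain F where F: "good D (F D)" if "dyck_path n D" for D by metis
  define \<phi> \<psi> where "\<phi> D = fst (F D)" and "\<psi> D = snd (F D)" for D
  have \<phi>: "bij_betw (\<phi> D) (?P D) (rise_rows (zeta_path D))"
    and \<psi>: "bij_betw (\<psi> D) (rise_rows D) (?P' (zeta_path D))"
    and \<phi>_weight: "p \<in> ?P D \<Longrightarrow> area_word (zeta_path D) (Suc (\<phi> D p)) = area_seq.weight n (area_word D) p"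
    and \<psi>_label: "j \<in> rise_rows D \<Longrightarrow> bounce_word (zeta_path D) (\<psi> D j) = area_word D (Suc j)"
    if "dyck_path n D" for D p j
    using F[OF that] unfolding good_def \<phi>_def \<psi>_def by blast+
  note inj_\<phi> = bij_betw_imp_inj_on[OF \<phi>] and inj_\<psi> = bij_betw_imp_inj_on[OF \<psi>]
  \<comment> \<open>Decorated rises become decorated peaks and conversely, which exchanges a and
    b.\<close>
  define \<zeta> where "\<zeta> D = \<lparr>path = zeta_path (path D), Peak = \<psi> (path D) ` Rise D, Rise = \<phi> (path D) ` Peak D\<rparr>"
    for D :: decorated_path
  have tilde: "D \<in> decorated_dyck_paths_tilde n a b \<longleftrightarrow> dyck_path n (path D) \<and>
      Peak D \<subseteq> ?P (path D) \<and> card (Peak D) = a \<and> Rise D \<subseteq> rise_rows (path D) \<and> card (Rise D) = b" for D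
    by (auto simp: decorated_dyck_paths_tilde_def decorated_dyck_paths_def)
  have hat: "D \<in> decorated_dyck_paths_hat n b a \<longleftrightarrow> dyck_path n (path D) \<and>
      Peak D \<subseteq> ?P' (path D) \<and> card (Peak D) = b \<and> Rise D \<subseteq> rise_rows (path D) \<and> card (Rise D) = a" for D
    by (auto simp: decorated_dyck_paths_hat_def decorated_dyck_paths_def)
  note zeta_bij = bij_betw_zeta_path[OF assms]
  have "inj_on \<zeta> (decorated_dyck_paths_tilde n a b)"
  proof (rule inj_onI)
    fix D D' assume DD': "D \<in> decorated_dyck_paths_tilde n a b" "D' \<in> decorated_dyck_paths_tilde n a b"
      and eq: "\<zeta> D = \<zeta> D'"
    note D = DD'[unfolded tilde]
    have path: "path D = path D'"
      using inj_onD[OF bij_betw_imp_inj_on[OF zeta_bij], of "path D" "path D'"] D eq by (simp add: \<zeta>_def)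
    have "Rise D = Rise D'"
      using inj_on_image_eq_iff[OF inj_\<psi>[of "path D"], of "Rise D" "Rise D'"] D eq path
      by (simp add: \<zeta>_def)
    moreover have "Peak D = Peak D'"
      using inj_on_image_eq_iff[OF inj_\<phi>[of "path D"], of "Peak D" "Peak D'"] D eq path
      by (simp add: \<zeta>_def)
    ultimately show "D = D'" using path by simp
  qed
  moreover have "\<zeta> ` decorated_dyck_paths_tilde n a b = decorated_dyck_paths_hat n b a"
  proof (intro subset_antisym subsetI)
    fix D' assume "D' \<in> \<zeta> ` decorated_dyck_paths_tilde n a b"
    then obtain D where D': "D' = \<zeta> D" and "D \<in> decorated_dyck_paths_tilde n a b" by blast
    then have D: "dyck_path n (path D)" "Peak D \<subseteq> ?P (path D)" "card (Peak D) = a"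
      "Rise D \<subseteq> rise_rows (path D)" "card (Rise D) = b" unfolding tilde by blast+
    have "dyck_path n (zeta_path (path D))" using bij_betwE[OF zeta_bij] D(1) by blast
    moreover have "\<psi> (path D) ` Rise D \<subseteq> ?P' (zeta_path (path D))"
      using bij_betw_imp_surj_on[OF \<psi>[OF D(1)]] D(4) by blast
    moreover have "\<phi> (path D) ` Peak D \<subseteq> rise_rows (zeta_path (path D))"
      using bij_betw_imp_surj_on[OF \<phi>[OF D(1)]] D(2) by blast
    moreover have "card (\<psi> (path D) ` Rise D) = b"
      using card_image[OF inj_on_subset[OF inj_\<psi>[OF D(1)] D(4)]] D(5) by simp
    moreover have "card (\<phi> (path D) ` Peak D) = a"
      using card_image[OF inj_on_subset[OF inj_\<phi>[OF D(1)] D(2)]] D(3) by simp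
    ultimately show "D' \<in> decorated_dyck_paths_hat n b a"
      unfolding hat D' \<zeta>_def decorated_path.simps by blast
  next
    fix D' assume "D' \<in> decorated_dyck_paths_hat n b a"
    then have D': "dyck_path n (path D')" "Peak D' \<subseteq> ?P' (path D')" "card (Peak D') = b"
      "Rise D' \<subseteq> rise_rows (path D')" "card (Rise D') = a" unfolding hat by blast+
    then have "path D' \<in> zeta_path ` {D. dyck_path n D}"
      using bij_betw_imp_surj_on[OF zeta_bij] by simp
    then obtain E where E: "dyck_path n E" "path D' = zeta_path E" by blast
    \<comment> \<open>The decorations are pulled back along the bijections attached to the
      undecorated preimage E.\<close>
    have "Peak D' \<subseteq> \<psi> E ` rise_rows E" using D'(2) bij_betw_imp_surj_on[OF \<psi>[OF E(1)]] E(2) by simp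
    then obtain R where R: "R \<subseteq> rise_rows E" "Peak D' = \<psi> E ` R" by (rule subset_imageE)
    have "Rise D' \<subseteq> \<phi> E ` ?P E" using D'(4) bij_betw_imp_surj_on[OF \<phi>[OF E(1)]] E(2) by simp
    then obtain Q where Q: "Q \<subseteq> ?P E" "Rise D' = \<phi> E ` Q" by (rule subset_imageE)
    have "card R = b"
      using card_image[OF inj_on_subset[OF inj_\<psi>[OF E(1)] R(1)]] R(2) D'(3) by simp
    moreover have "card Q = a"
      using card_image[OF inj_on_subset[OF inj_\<phi>[OF E(1)] Q(1)]] Q(2) D'(5) by simp
    ultimately have "\<lparr>path = E, Peak = Q, Rise = R\<rparr> \<in> decorated_dyck_paths_tilde n a b"
      unfolding tilde decorated_path.simps using E(1) Q(1) R(1) by blast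
    moreover have "\<zeta> \<lparr>path = E, Peak = Q, Rise = R\<rparr> = D'"
      using E(2) R(2) Q(2) by (simp add: \<zeta>_def)
    ultimately show "D' \<in> \<zeta> ` decorated_dyck_paths_tilde n a b" by (metis imageI)
  qed
  moreover have "area D = int (bounce (\<zeta> D)) \<and> int (dinv D) = area (\<zeta> D)"
    if "D \<in> decorated_dyck_paths_tilde n a b" for D
  proof -
    let ?D = "path D" and ?Z = "zeta_path (path D)"
    have D: "dyck_path n ?D" "Peak D \<subseteq> ?P ?D" "Rise D \<subseteq> rise_rows ?D"
      using that unfolding tilde by blast+
    have Z: "dyck_path n ?Z" using bij_betwE[OF zeta_bij] D(1) by blast
    note size = dyck_pathD(1)[OF D(1)] dyck_pathD(1)[OF Z]
    interpret area_seq n "area_word ?D" by (rule area_seq_area_word[OF D(1) assms])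
    have zeta: "?Z = zeta" using size by (simp add: zeta_path_def)
    have rows: "peak_rows ?D \<subseteq> {1..n}" "peak_rows ?Z \<subseteq> {1..n}" "rise_rows ?Z \<subseteq> {1..n}"
      using size by (auto simp: peak_rows_def rise_rows_def)
    have sub: "Peak D \<subseteq> {1..n}" using D rows by blast
    have "\<psi> ?D ` Rise D \<subseteq> ?P' ?Z"
      using image_mono[OF D(3), of "\<psi> ?D"] unfolding bij_betw_imp_surj_on[OF \<psi>[OF D(1)]] .
    then have images: "\<psi> ?D ` Rise D \<subseteq> {1..n}" using rows(2) by (meson Diff_subset subset_trans)
    note inj = inj_on_subset[OF inj_\<psi>[OF D(1)] D(3)] inj_on_subset[OF inj_\<phi>[OF D(1)] D(2)]
    \<comment> \<open>What \<open>area D\<close> subtracts equals the sum of the bounce labels in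
      the decorated rows, which \<open>bounce\<close> omits.\<close>
    have "(\<Sum>j\<in>Rise D. int (area_word ?D (j + 1))) = int (\<Sum>i\<in>\<psi> ?D ` Rise D. bounce_word ?Z i)"
      using \<psi>_label[OF D(1) subsetD[OF D(3)]] by (simp add: sum.reindex[OF inj(1)])
    moreover have "(\<Sum>i=1..n. bounce_word ?Z i) =
        (\<Sum>i\<in>{1..n} - \<psi> ?D ` Rise D. bounce_word ?Z i) + (\<Sum>i\<in>\<psi> ?D ` Rise D. bounce_word ?Z i)"
      using images by (intro sum.subset_diff) auto
    ultimately have 1: "area D = int (bounce (\<zeta> D))"
      using sum_bounce_word_zeta zeta by (simp add: area_def bounce_def \<zeta>_def size count_zeta flip: of_nat_sum)
    \<comment> \<open>Likewise, the area lost at the decorated rises of the image equals the dinv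
      lost at the decorated peaks.\<close>
    have "(\<Sum>j\<in>\<phi> ?D ` Peak D. int (area_word ?Z (j + 1))) = int (\<Sum>p\<in>Peak D. weight p)"
      using \<phi>_weight[OF D(1) subsetD[OF D(2)]] by (simp add: sum.reindex[OF inj(2)])
    moreover have "(\<Sum>p=1..n. weight p) = (\<Sum>p\<in>{1..n} - Peak D. weight p) + (\<Sum>p\<in>Peak D. weight p)"
      using sub by (intro sum.subset_diff) auto
    moreover have "dinv D = (\<Sum>p\<in>{1..n} - Peak D. weight p)"
      unfolding dinv_def size by (rule card_dinv_pairs)
    ultimately have 2: "int (dinv D) = area (\<zeta> D)"
      using sum_area_word_zeta zeta by (simp add: area_def \<zeta>_def size count_zeta flip: of_nat_sum)
    show ?thesis using 1 2 by simp
  qed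
  ultimately show ?thesis unfolding bij_betw_def by blast
qed

end
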